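(* Let $(r_j)_{j\ge1},(s_j)_{j\ge1},(t_j)_{j\ge1}$ be sequences of real numbers with $0<r_j<s_j<t_j$ for all $j$, and let $(z_j)_{j\ge1}$ be a sequence of points of $E$ with $z_j\to0$, such that $\overline{\triangle}(z_j,t_j)\cap\overline{\triangle}(z_k,t_k)=\emptyset$ for all $j\ne k$ and $0\notin\overline{\triangle}(z_j,r_j)$ for all $j$. Assume that for every $j\ge1$ $$t_j<e^{-4},\quad r_j^2<\frac{|z_j|^2}{2},\quad \frac{r_j^2}{t_j^2}+\frac{s_j}{t_j}+\sqrt{\frac{2\log s_j}{\log r_j}}<1,\quad \frac{2\log t_j}{\log r_j}+\sqrt{\frac{2\log s_j}{\log r_j}}+\frac{s_j}{t_j}<1.$$ Let $$D:=E\setminus\Big(\bigcup_{j=1}^{\infty}\overline{\triangle}(z_j,r_j)\cup\{0\}\Big).$$ Assume that $$\sum_{N=1}^{\infty}\frac{s_N}{t_N}<\infty,\qquad \sum_{N=1}^{\infty}\sqrt{\frac{\log s_N}{\log r_N}}<\infty,\qquad \sum_{N=1}^{\infty}\frac{-1}{\log r_N}<\infty.$$ Assume also that each $z_N$ is a positive real number, $N=1,2,\ldots$, and that $$\sum_{N=1}^{\infty}\left(\frac{-1}{z_N^2\log r_N}+\frac{r_N^2}{(z_N^2-r_N^2)^2}\right)<\infty.$$ Then $$\liminf_{D\ni z\to0}K_D(z)<\infty.$$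
   Context: $\triangle(a,r)$ denotes the open disc in $\mathbb{C}$ with center $a$ and radius $r>0$, $\overline{\triangle}(a,r)$ its closure, and $E=\triangle(0,1)$ the unit disc. For a bounded domain $\Omega\subset\mathbb{C}$, $L_h^2(\Omega)$ denotes the space of holomorphic functions on $\Omega$ that are square integrable with respect to Lebesgue measure, and the Bergman kernel (on the diagonal) is $$K_\Omega(z)=\sup\left\{\frac{|f(z)|^2}{\|f\|_{L^2(\Omega)}^2}: f\in L_h^2(\Omega),\ f\not\equiv 0\right\},\quad z\in\Omega.$$ *)

theory Defs
  imports "HOL-Complex_Analysis.Complex_Analysis"
begin

text \<open>
  Functions are total in HOL, so the Bergman space consists of functions on the whole plane of
  which only the restriction to \<open>\<Omega>\<close> matters; accordingly ``not identically zero'' in the definition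
  of the kernel means not identically zero on \<open>\<Omega>\<close>.
\<close>

definition bergman_space :: "complex set \<Rightarrow> (complex \<Rightarrow> complex) set" where
  "bergman_space \<Omega> =
     {f. f holomorphic_on \<Omega> \<and> set_integrable lebesgue \<Omega> (\<lambda>w. (cmod (f w))\<^sup>2)}"

definition bergman_norm :: "complex set \<Rightarrow> (complex \<Rightarrow> complex) \<Rightarrow> real" where
  "bergman_norm \<Omega> f = sqrt (LINT w:\<Omega>|lebesgue. (cmod (f w))\<^sup>2)"

text \<open>
  The supremum is taken in the extended nonnegative reals, so that it is meaningful without a
  prior proof that it is finite.
\<close>

definition bergman_kernel :: "complex set \<Rightarrow> complex \<Rightarrow> ennreal" where
  "bergman_kernel \<Omega> z =
     (SUP f \<in> {f \<in> bergman_space \<Omega>. \<exists>w\<in>\<Omega>. f w \<noteq> 0}.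
        ennreal ((cmod (f z))\<^sup>2 / (bergman_norm \<Omega> f)\<^sup>2))"

end

theory Submission
  imports Defs
begin

text \<open>
  The kernel is bounded along the negative real axis.  Let \<open>f\<close> be holomorphic and square integrable
  on \<open>D\<close>, let \<open>a = -x\<close> with \<open>x > 0\<close> small, and let \<open>u\<close> be a cutoff function with compact support in
  \<open>D\<close> which is \<open>1\<close> near \<open>a\<close>.  The Cauchy--Pompeiu formula expresses \<open>f a\<close> as an integral of
  \<open>f \<cdot> \<partial>u/\<partial>(cnj w)\<close> against the Cauchy kernel, so that
  \<open>\<bar>f a\<bar>\<^sup>2 \<le> C \<parallel>f\<parallel>\<^sup>2 \<integral> \<bar>\<nabla>u\<bar>\<^sup>2 / \<bar>w - a\<bar>\<^sup>2\<close>.  Take logarithmic cutoffs, of energy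
  \<open>O(1 / ln (s\<^sub>j / r\<^sub>j)) = O(-1 / ln r\<^sub>j)\<close>, around the holes; as the distance from \<open>a\<close> to the \<open>j\<close>-th hole
  is at least comparable to \<open>z\<^sub>j\<close>, they contribute a multiple of \<open>-1 / (z\<^sub>j\<^sup>2 ln r\<^sub>j)\<close> each.  The origin is
  cut off at arbitrarily small cost, which leaves only finitely many holes at a time.
\<close>

section \<open>Gradients of compactly supported functions\<close>

text \<open>
  By translation invariance the difference quotients have integral \<open>0\<close>; this passes to the limit
  without Fubini and without continuity of the derivative.
\<close>

lemma
  fixes F :: "'a::euclidean_space \<Rightarrow> 'b::{banach, second_countable_topology}"
  assumes der: "\<And>x. (F has_derivative F' x) (at x)"
    and bd: "\<And>x. onorm (F' x) \<le> B"
    and S: "bounded S" "\<And>x. x \<notin> S \<Longrightarrow> F x = 0"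
  shows integrable_derivative_compact_support: "integrable lborel (\<lambda>x. F' x v)"
    and integral_derivative_compact_support: "integral\<^sup>L lborel (\<lambda>x. F' x v) = 0"
proof -
  obtain R where R: "S \<subseteq> cball 0 R"
    using S(1) unfolding bounded_iff by (metis mem_cball_0 subsetI)
  have contF: "continuous_on UNIV F"
    by (intro continuous_at_imp_continuous_on ballI has_derivative_continuous[OF der])
  have Fmeas: "F \<in> borel_measurable borel"
    using contF by (rule borel_measurable_continuous_onI)
  have Lip: "norm (F x - F y) \<le> B * norm (x - y)" for x y
    by (rule differentiable_bound[of UNIV F F']) (use der bd in auto)
  have intF: "integrable lborel F"
  proof -
    have "integrable lborel (\<lambda>x. indicator (cball 0 R) x *\<^sub>R F x)"
      by (rule borel_integrable_compact) (auto intro: continuous_on_subset[OF contF])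
    moreover have "(\<lambda>x. indicator (cball 0 R) x *\<^sub>R F x) = F"
    proof
      show "indicator (cball 0 R) x *\<^sub>R F x = F x" for x
        using R S(2)[of x] by (cases "x \<in> S") (auto simp: indicator_def)
    qed
    ultimately show ?thesis by simp
  qed
  define c where "c n = (1 / real (Suc n)) *\<^sub>R v" for n
  define s where "s n x = real (Suc n) *\<^sub>R (F (c n + x) - F x)" for n x
  \<comment> \<open>Dominating function for the difference quotients: translation by
    \<open>c n\<close> moves the support by at most \<open>norm v\<close>, hence the radius
    \<open>R + norm v\<close>, and \<open>B\<close> is a Lipschitz constant of
    \<open>F\<close>.\<close>
  define w where "w x = indicator (cball 0 (R + norm v)) x *\<^sub>R (B * norm v)" for x :: 'a
  have c_le: "norm (c n) \<le> norm v" for n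
    using mult_left_mono[of 1 "1 + real n" "norm v"] by (simp add: c_def divide_le_eq)
  have intFc: "integrable lborel (\<lambda>x. F (c n + x))"
    and intFc_eq: "integral\<^sup>L lborel (\<lambda>x. F (c n + x)) = integral\<^sup>L lborel F" for n
  proof -
    have "integrable (distr lborel borel ((+) (c n))) F"
      using intF by (simp add: lborel_distr_plus)
    then show "integrable lborel (\<lambda>x. F (c n + x))"
      by (subst (asm) integrable_distr_eq) (auto simp: Fmeas)
    have "integral\<^sup>L lborel F = integral\<^sup>L (distr lborel borel ((+) (c n))) F"
      by (simp add: lborel_distr_plus)
    also have "\<dots> = integral\<^sup>L lborel (\<lambda>x. F (c n + x))"
      by (subst integral_distr) (auto simp: Fmeas)
    finally show "integral\<^sup>L lborel (\<lambda>x. F (c n + x)) = integral\<^sup>L lborel F" ..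
  qed
  have s0: "integral\<^sup>L lborel (s n) = 0" for n
    unfolding s_def by (simp add: intF intFc intFc_eq)
  have smeas: "s n \<in> borel_measurable lborel" for n
    unfolding s_def
    by (intro borel_measurable_integrable integrable_scaleR_right Bochner_Integration.integrable_diff intF intFc)
  have lim: "(\<lambda>n. s n x) \<longlonglongrightarrow> F' x v" for x
  proof -
    have "((\<lambda>t. F (x + t *\<^sub>R v)) has_derivative (\<lambda>t. t *\<^sub>R F' x v)) (at 0)"
    proof (rule has_derivative_eq_rhs)
      show "((\<lambda>t. F (x + t *\<^sub>R v)) has_derivative (\<lambda>t. F' x (t *\<^sub>R v))) (at 0)"
        by (rule has_derivative_compose[of _ _ _ _ F]) (auto intro!: derivative_eq_intros simp: der)
      show "(\<lambda>t. F' x (t *\<^sub>R v)) = (\<lambda>t. t *\<^sub>R F' x v)"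
        using linear_cmul[OF has_derivative_linear[OF der[of x]]] by auto
    qed
    then have *: "((\<lambda>t. norm (F (x + t *\<^sub>R v) - F x - t *\<^sub>R F' x v) / norm t) \<longlongrightarrow> 0) (at 0)"
      by (simp add: has_derivative_at)
    have "((\<lambda>t. norm ((F (x + t *\<^sub>R v) - F x) /\<^sub>R t - F' x v)) \<longlongrightarrow> 0) (at 0)"
    proof (rule Lim_transform_eventually[OF *])
      have "norm (F (x + t *\<^sub>R v) - F x - t *\<^sub>R F' x v) / norm t
          = norm ((F (x + t *\<^sub>R v) - F x) /\<^sub>R t - F' x v)" if "t \<noteq> 0" for t
      proof -
        have "(F (x + t *\<^sub>R v) - F x) /\<^sub>R t - F' x v
            = (F (x + t *\<^sub>R v) - F x - t *\<^sub>R F' x v) /\<^sub>R t"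
          using that by (simp add: scaleR_diff_right)
        then show ?thesis
          by (simp add: divide_inverse_commute)
      qed
      then show "\<forall>\<^sub>F t in at 0. norm (F (x + t *\<^sub>R v) - F x - t *\<^sub>R F' x v) / norm t
          = norm ((F (x + t *\<^sub>R v) - F x) /\<^sub>R t - F' x v)"
        by (auto simp: eventually_at intro!: exI[of _ 1])
    qed
    then have "((\<lambda>t. (F (x + t *\<^sub>R v) - F x) /\<^sub>R t) \<longlongrightarrow> F' x v) (at 0)"
      by (rule LIM_zero_cancel[OF tendsto_norm_zero_cancel])
    moreover have "filterlim (\<lambda>n. 1 / real (Suc n)) (at 0) sequentially"
      by (intro filterlim_atI) (use LIMSEQ_inverse_real_of_nat in \<open>auto simp: inverse_eq_divide\<close>)
    ultimately have "(\<lambda>n. (F (x + (1 / real (Suc n)) *\<^sub>R v) - F x) /\<^sub>R (1 / real (Suc n))) \<longlonglongrightarrow> F' x v"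
      by (rule filterlim_compose)
    then show ?thesis
      unfolding s_def c_def by (simp add: add.commute)
  qed
  have wint: "integrable lborel w"
    unfolding w_def by (intro borel_integrable_compact) auto
  have sw: "norm (s n x) \<le> w x" for n x
  proof (cases "x \<in> cball 0 (R + norm v)")
    case True
    have "norm (s n x) \<le> real (Suc n) * (B * norm (c n))"
      unfolding s_def using Lip[of "c n + x" x] by (auto intro: mult_left_mono)
    also have "\<dots> = B * norm v"
      by (simp add: c_def)
    finally show ?thesis using True by (simp add: w_def)
  next
    case False
    have "x \<notin> cball 0 R" using False norm_ge_zero[of v] unfolding mem_cball_0 by linarith
    then have "x \<notin> S" using R by blast
    moreover have "c n + x \<notin> cball 0 R"
    proof
      assume "c n + x \<in> cball 0 R"
      then have "norm x \<le> R + norm (c n)"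
        using norm_triangle_ineq4[of "c n + x" "c n"] by simp
      then show False using False c_le[of n] by simp
    qed
    then have "c n + x \<notin> S" using R by blast
    ultimately show ?thesis
      using False S(2) by (simp add: s_def w_def)
  qed
  have F'meas: "(\<lambda>x. F' x v) \<in> borel_measurable lborel"
    by (rule borel_measurable_LIMSEQ_metric[OF smeas]) (rule lim)
  show "integrable lborel (\<lambda>x. F' x v)"
    by (rule integrable_dominated_convergence[where s=s, OF F'meas smeas wint]) (auto simp: lim sw)
  have "(\<lambda>n. integral\<^sup>L lborel (s n)) \<longlonglongrightarrow> integral\<^sup>L lborel (\<lambda>x. F' x v)"
    by (rule integral_dominated_convergence[where s=s, OF F'meas smeas wint]) (auto simp: lim sw)
  then show "integral\<^sup>L lborel (\<lambda>x. F' x v) = 0"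
    by (simp add: s0 LIMSEQ_const_iff)
qed

lemma GDERIV_eq_0_outside_closed:
  assumes K: "closed K" "\<And>w. w \<notin> K \<Longrightarrow> u w = 0" and grad: "\<And>w. GDERIV u w :> g w"
    and w: "w \<notin> K"
  shows "g w = 0"
proof -
  have "(u has_derivative (\<lambda>k. 0)) (at w)"
    by (rule has_derivative_transform_within_open[OF has_derivative_const[of 0], of "- K"])
      (use w K in \<open>auto simp: open_Compl\<close>)
  from has_derivative_unique[OF this grad[of w, unfolded gderiv_def]]
  have "inner (g w) (g w) = 0" by metis
  then show ?thesis by simp
qed

text \<open>
  As a complex number, the gradient of the real function \<open>u\<close> is \<open>2 \<partial>u/\<partial>(cnj w)\<close>.
\<close>

lemma
  fixes h :: "complex \<Rightarrow> complex" and u :: "complex \<Rightarrow> real"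
  assumes hol: "h holomorphic_on U" and U: "open U"
    and K: "compact K" "K \<subseteq> U" "\<And>w. w \<notin> K \<Longrightarrow> u w = 0"
    and grad: "\<And>w. GDERIV u w :> g w"
    and M: "\<And>w. norm (g w) \<le> M"
  shows integrable_holomorphic_mult_grad: "integrable lborel (\<lambda>w. h w * g w)"
    and integral_holomorphic_mult_grad: "integral\<^sup>L lborel (\<lambda>w. h w * g w) = 0"
proof -
  have g0: "g w = 0" if "w \<notin> K" for w
    using GDERIV_eq_0_outside_closed[OF compact_imp_closed[OF K(1)] K(3) grad that] .
  define F where "F w = h w * of_real (u w)" for w
  \<comment> \<open>The function \<open>h\<close> is only controlled on \<open>U\<close>, so the
    product rule is applied on \<open>K\<close>; off \<open>K\<close> the function \<open>F\<close>
    vanishes on an open set.\<close>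
  define F' where "F' w k = (if w \<in> K
     then h w * of_real (inner k (g w)) + deriv h w * k * of_real (u w) else 0)" for w k
  have contdh: "continuous_on K (deriv h)" and conth: "continuous_on K h"
    using hol U K(2) by (meson continuous_on_subset holomorphic_deriv holomorphic_on_imp_continuous_on)+
  have contu: "continuous_on K u"
    using grad unfolding gderiv_def
    by (meson continuous_at_imp_continuous_on has_derivative_continuous)
  obtain A1 where A1: "\<And>w. w \<in> K \<Longrightarrow> norm (h w) \<le> A1" "A1 > 0"
    using compact_imp_bounded[OF compact_continuous_image[OF conth K(1)]]
    by (auto simp: bounded_pos)
  obtain A2 where A2: "\<And>w. w \<in> K \<Longrightarrow> norm (deriv h w) \<le> A2" "A2 > 0"
    using compact_imp_bounded[OF compact_continuous_image[OF contdh K(1)]]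
    by (auto simp: bounded_pos)
  obtain A3 where A3: "\<And>w. w \<in> K \<Longrightarrow> norm (u w) \<le> A3" "A3 > 0"
    using compact_imp_bounded[OF compact_continuous_image[OF contu K(1)]]
    by (auto simp: bounded_pos)
  have M0: "M \<ge> 0" using M[of 0] norm_ge_zero[of "g 0"] by linarith
  have der: "(F has_derivative F' w) (at w)" for w
  proof (cases "w \<in> K")
    case True
    have "(h has_field_derivative deriv h w) (at w)"
      using hol U K(2) True by (meson holomorphic_derivI subsetD)
    then have h': "(h has_derivative (\<lambda>k. deriv h w * k)) (at w)"
      by (simp add: has_field_derivative_def)
    have c': "((\<lambda>w. complex_of_real (u w)) has_derivative (\<lambda>k. of_real (inner k (g w)))) (at w)"
      using grad[of w] unfolding gderiv_def by (rule has_derivative_of_real)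
    show ?thesis
      using has_derivative_mult[OF h' c'] True unfolding F_def F'_def
      by simp
  next
    case False
    have "(F has_derivative (\<lambda>k. 0)) (at w)"
      by (rule has_derivative_transform_within_open[OF has_derivative_const[of 0], of "- K"])
        (use False K in \<open>auto simp: open_Compl compact_imp_closed F_def\<close>)
    moreover have "F' w = (\<lambda>k. 0)" using False by (auto simp: F'_def)
    ultimately show ?thesis by simp
  qed
  have bd: "onorm (F' w) \<le> A1 * M + A2 * A3" for w
  proof (rule onorm_le)
    fix k
    show "norm (F' w k) \<le> (A1 * M + A2 * A3) * norm k"
    proof (cases "w \<in> K")
      case True
      have "norm (F' w k) \<le> norm (h w) * \<bar>inner k (g w)\<bar> + norm (deriv h w) * norm k * \<bar>u w\<bar>"
        using True by (auto simp: F'_def norm_mult intro!: order_trans[OF norm_triangle_ineq])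
      also have "\<dots> \<le> A1 * (norm k * M) + A2 * norm k * A3"
      proof (intro add_mono mult_mono)
        show "\<bar>inner k (g w)\<bar> \<le> norm k * M"
          using Cauchy_Schwarz_ineq2[of k "g w"] M[of w]
          by (meson mult_left_mono norm_ge_zero order_trans)
      qed (use True A1 A2 A3 in auto)
      finally show ?thesis by (simp add: algebra_simps)
    next
      case False
      then show ?thesis using A1 A2 A3 M0 by (simp add: F'_def)
    qed
  qed
  have F0: "F w = 0" if "w \<notin> K" for w
    using that K by (simp add: F_def)
  note D = integrable_derivative_compact_support[OF der bd compact_imp_bounded[OF K(1)] F0]
    integral_derivative_compact_support[OF der bd compact_imp_bounded[OF K(1)] F0]
  \<comment> \<open>The combination on the right is twice the derivative of \<open>h u\<close> in
    \<open>cnj w\<close>. It annihilates the holomorphic factor, because i^2 = -1, and leaves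
    \<open>h\<close> times the gradient of \<open>u\<close>.\<close>
  have eq: "h w * g w = F' w 1 + \<i> * F' w \<i>" for w
  proof (cases "w \<in> K")
    case True
    have g: "complex_of_real (inner 1 (g w)) + \<i> * of_real (inner \<i> (g w)) = g w"
      by (simp add: complex_eq_iff inner_complex_def)
    have "F' w 1 + \<i> * F' w \<i>
        = h w * (of_real (inner 1 (g w)) + \<i> * of_real (inner \<i> (g w)))
          + (1 + \<i> * \<i>) * (deriv h w * of_real (u w))"
      unfolding F'_def using True by (simp only: if_True ring_distribs mult_1 mult_1_right mult_ac add_ac)
    then show ?thesis by (simp only: g) simp
  next
    case False
    then show ?thesis using g0 by (simp add: F'_def)
  qed
  show "integrable lborel (\<lambda>w. h w * g w)"
    unfolding eq using D by auto
  show "integral\<^sup>L lborel (\<lambda>w. h w * g w) = 0"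
    unfolding eq using D by (simp)
qed

section \<open>Logarithmic cutoff functions\<close>

text \<open>
  With \<open>p x = (max 0 x)\<^sup>2\<close>, which is continuously differentiable, this is \<open>1 - p (1 - p x)\<close>.
\<close>

definition step :: "real \<Rightarrow> real" where
  "step x = 1 - (max 0 (1 - (max 0 x)\<^sup>2))\<^sup>2"

definition step_deriv :: "real \<Rightarrow> real" where
  "step_deriv x = 4 * max 0 x * max 0 (1 - (max 0 x)\<^sup>2)"

lemma DERIV_max_0_power2: "((\<lambda>x. (max 0 x)\<^sup>2) has_real_derivative 2 * max 0 x) (at (x::real))"
proof (cases "x = 0")
  case True
  have "((\<lambda>y::real. (max 0 y)\<^sup>2 / y) \<longlongrightarrow> 0) (at 0)"
  proof (rule Lim_null_comparison)
    show "\<forall>\<^sub>F y::real in at 0. norm ((max 0 y)\<^sup>2 / y) \<le> \<bar>y\<bar>"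
      by (auto simp: eventually_at power2_eq_square max_def intro!: exI[of _ 1])
    show "((\<lambda>y::real. \<bar>y\<bar>) \<longlongrightarrow> 0) (at 0)"
      using tendsto_rabs[OF tendsto_ident_at[of "0::real"]] by simp
  qed
  then show ?thesis
    using True by (simp add: has_field_derivative_iff)
next
  case False
  show ?thesis
  proof (cases "x > 0")
    case True
    have "((\<lambda>x. x\<^sup>2) has_real_derivative 2 * max 0 x) (at x)"
      using True by (auto intro!: derivative_eq_intros)
    then show ?thesis
      by (rule DERIV_cong_ev[THEN iffD1, rotated -1])
        (use True in \<open>auto intro!: eventually_mono[OF eventually_nhds_in_open[of "{0<..}"]]\<close>)
  next
    case x: False
    have "((\<lambda>x. 0) has_real_derivative 2 * max 0 x) (at x)"
      using x by (auto intro!: derivative_eq_intros)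
    then show ?thesis
      by (rule DERIV_cong_ev[THEN iffD1, rotated -1])
        (use x False in \<open>auto intro!: eventually_mono[OF eventually_nhds_in_open[of "{..<0}"]]\<close>)
  qed
qed

lemma DERIV_step: "(step has_real_derivative step_deriv x) (at x)"
proof -
  have "((\<lambda>x. 1 - (max 0 (1 - (max 0 x)\<^sup>2))\<^sup>2) has_real_derivative
      - (2 * max 0 (1 - (max 0 x)\<^sup>2) * - (2 * max 0 x))) (at x)"
    by (rule DERIV_chain2[OF DERIV_max_0_power2] derivative_eq_intros DERIV_max_0_power2 refl | simp)+
  then show ?thesis
    by (simp add: step_def[abs_def] step_deriv_def mult_ac)
qed

lemma step_eq_0: "x \<le> 0 \<Longrightarrow> step x = 0"
  by (simp add: step_def)

lemma step_eq_1: "x \<ge> 1 \<Longrightarrow> step x = 1"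
  by (simp add: step_def)

lemma step_bounds: "0 \<le> step x" "step x \<le> 1"
  by (auto simp: step_def power_le_one_iff)

lemma step_deriv_eq_0: "x \<le> 0 \<or> x \<ge> 1 \<Longrightarrow> step_deriv x = 0"
  by (auto simp: step_deriv_def)

lemma step_deriv_bounds: "0 \<le> step_deriv x" "step_deriv x \<le> 4"
proof -
  show "0 \<le> step_deriv x" by (simp add: step_deriv_def)
  show "step_deriv x \<le> 4"
  proof (cases "x \<ge> 1")
    case False
    have "max 0 x * max 0 (1 - (max 0 x)\<^sup>2) \<le> 1 * 1"
      using False by (intro mult_mono) auto
    then show ?thesis by (simp add: step_deriv_def)
  qed (simp add: step_deriv_eq_0)
qed

text \<open>A definite slope in the middle of the transition zone; this is what gives the averaging
  weight in \<open>integral_annulus_kernel_ge\<close> a definite mass.\<close>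

lemma step_deriv_ge:
  assumes "1/4 \<le> x" "x \<le> 1/2"
  shows "step_deriv x \<ge> 3/4"
proof -
  have "x\<^sup>2 \<le> (1/2)\<^sup>2" using assms by (intro power_mono) auto
  then have x2: "3/4 \<le> 1 - x\<^sup>2" by (simp add: power2_eq_square)
  have "1/4 * (3/4) \<le> x * (1 - x\<^sup>2)"
    using assms x2 by (intro mult_mono) auto
  moreover have "step_deriv x = 4 * (x * (1 - x\<^sup>2))"
    using assms x2 by (simp add: step_deriv_def max_def)
  ultimately show ?thesis by linarith
qed

text \<open>
  Near \<open>c\<close> the value is \<open>0\<close>; at \<open>c\<close> itself this relies on \<open>ln 0 = 0\<close>.
\<close>

definition log_cutoff :: "'a::real_inner \<Rightarrow> real \<Rightarrow> real \<Rightarrow> 'a \<Rightarrow> real" where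
  "log_cutoff c r s w = step (ln (norm (w - c) / r) / ln (s / r))"

text \<open>The chain rule gives a factor \<open>1 / (ln (s / r) * norm (w - c))\<close>, and the
  gradient of the norm is the unit vector \<open>(w - c) / norm (w - c)\<close>; together they
  produce the squared norm in the denominator.\<close>

definition log_cutoff_grad :: "'a::real_inner \<Rightarrow> real \<Rightarrow> real \<Rightarrow> 'a \<Rightarrow> 'a" where
  "log_cutoff_grad c r s w =
     (step_deriv (ln (norm (w - c) / r) / ln (s / r)) / (ln (s / r) * (norm (w - c))\<^sup>2)) *\<^sub>R (w - c)"

lemma log_ratio_le_0:
  assumes "0 < r" "r < s" "0 \<le> x" "x \<le> r"
  shows "ln (x / r) / ln (s / r) \<le> (0::real)"
  using assms by (cases "x = 0") (auto simp: field_simps intro!: divide_nonpos_pos)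

lemma log_ratio_ge_1:
  assumes "0 < r" "r < s" "s \<le> x"
  shows "ln (x / r) / ln (s / r) \<ge> (1::real)"
  using assms by (auto simp: le_divide_eq divide_right_mono)

lemma log_cutoff_eq_0: "0 < r \<Longrightarrow> r < s \<Longrightarrow> norm (w - c) \<le> r \<Longrightarrow> log_cutoff c r s w = 0"
  unfolding log_cutoff_def by (intro step_eq_0 log_ratio_le_0) auto

lemma log_cutoff_eq_1: "0 < r \<Longrightarrow> r < s \<Longrightarrow> s \<le> norm (w - c) \<Longrightarrow> log_cutoff c r s w = 1"
  unfolding log_cutoff_def by (intro step_eq_1 log_ratio_ge_1) auto

lemma log_cutoff_bounds: "0 \<le> log_cutoff c r s w" "log_cutoff c r s w \<le> 1"
  by (simp_all add: log_cutoff_def step_bounds)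

lemma log_cutoff_grad_eq_0:
  assumes "0 < r" "r < s" "norm (w - c) \<le> r \<or> s \<le> norm (w - c)"
  shows "log_cutoff_grad c r s w = 0"
proof -
  have "step_deriv (ln (norm (w - c) / r) / ln (s / r)) = 0"
    using assms log_ratio_le_0[of r s "norm (w - c)"] log_ratio_ge_1[of r s "norm (w - c)"]
    by (intro step_deriv_eq_0) auto
  then show ?thesis by (simp add: log_cutoff_grad_def)
qed

lemma GDERIV_log_cutoff:
  assumes "0 < r" "r < s"
  shows "GDERIV (log_cutoff c r s) w :> log_cutoff_grad c r s w"
proof (cases "w = c")
  case True
  have "(log_cutoff c r s has_derivative (\<lambda>h. 0)) (at w)"
    by (rule has_derivative_transform_within_open[OF has_derivative_const[of 0], of "ball c r"])
      (use assms True in \<open>auto simp: log_cutoff_eq_0 dist_norm norm_minus_commute\<close>)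
  then show ?thesis
    using True by (simp add: gderiv_def log_cutoff_grad_def)
next
  case False
  define L where "L = ln (s / r)"
  have L: "L > 0" using assms by (simp add: L_def)
  have n: "norm (w - c) > 0" using False by simp
  have "((\<lambda>w. w - c) has_derivative (\<lambda>h. h)) (at w)"
    by (auto intro!: derivative_eq_intros)
  from has_derivative_compose[OF this, of norm "\<lambda>h. inner h (sgn (w - c))"]
  have 1: "GDERIV (\<lambda>w. norm (w - c)) w :> sgn (w - c)"
    using False by (simp add: gderiv_def has_derivative_norm)
  have 2: "DERIV (\<lambda>x. step (ln (x / r) / L)) (norm (w - c)) :>
      step_deriv (ln (norm (w - c) / r) / L) * (1 / (L * norm (w - c)))"
    by (rule DERIV_chain2[OF DERIV_step])
      (use n L assms in \<open>auto intro!: derivative_eq_intros simp: field_simps\<close>)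
  from GDERIV_DERIV_compose[OF 1 2]
  show ?thesis
    unfolding log_cutoff_def[abs_def] log_cutoff_grad_def L_def
    by (rule GDERIV_subst) (simp add: sgn_div_norm power2_eq_square divide_inverse)
qed

text \<open>The gradient has size at most \<open>4 / (ln (s / r) * norm (w - c))\<close> and lives
  where the norm exceeds \<open>r\<close>. A uniform bound of this kind is a hypothesis of
  \<open>integral_holomorphic_mult_grad\<close>.\<close>

lemma norm_log_cutoff_grad_le:
  assumes "0 < r" "r < s"
  shows "norm (log_cutoff_grad c r s w) \<le> 4 / (ln (s / r) * r)"
proof (cases "norm (w - c) \<le> r")
  case True
  then show ?thesis using assms by (simp add: log_cutoff_grad_eq_0)
next
  case False
  then have n: "norm (w - c) > r" by simp
  have L: "ln (s / r) > 0" using assms by simp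
  have "norm (log_cutoff_grad c r s w)
      = step_deriv (ln (norm (w - c) / r) / ln (s / r)) / (ln (s / r) * norm (w - c))"
    using L n assms(1) step_deriv_bounds(1)
    by (simp add: log_cutoff_grad_def power2_eq_square abs_mult)
  also have "\<dots> \<le> 4 / (ln (s / r) * r)"
    using L n assms(1) step_deriv_bounds
    by (intro frac_le mult_left_mono mult_pos_pos) (auto intro: less_imp_le)
  finally show ?thesis .
qed

section \<open>Energy of logarithmic cutoffs\<close>

definition log_density :: "complex \<Rightarrow> real \<Rightarrow> real \<Rightarrow> complex \<Rightarrow> real" where
  "log_density c r s w = indicator (cball c s - ball c r) w * (16 / ((ln (s / r))\<^sup>2 * (norm (w - c))\<^sup>2))"

lemma log_density_nonneg: "0 \<le> log_density c r s w"
  by (simp add: log_density_def)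

text \<open>The constant 16 in \<open>log_density\<close> is the square of the bound 4 on
  \<open>step_deriv\<close>.\<close>

lemma norm_log_cutoff_grad_power2_le:
  assumes "0 < r" "r < s"
  shows "(norm (log_cutoff_grad c r s w))\<^sup>2 \<le> log_density c r s w"
proof (cases "norm (w - c) \<le> r \<or> s \<le> norm (w - c)")
  case True
  then show ?thesis using assms by (simp add: log_cutoff_grad_eq_0 log_density_nonneg)
next
  case False
  then have n: "norm (w - c) > r" "norm (w - c) < s" by auto
  have L: "ln (s / r) > 0" using assms by simp
  have "norm (log_cutoff_grad c r s w)
      = step_deriv (ln (norm (w - c) / r) / ln (s / r)) / (ln (s / r) * norm (w - c))"
    using L n assms(1) step_deriv_bounds(1)
    by (simp add: log_cutoff_grad_def power2_eq_square abs_mult)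
  also have "\<dots> \<le> 4 / (ln (s / r) * norm (w - c))"
    using L n assms(1) step_deriv_bounds by (intro divide_right_mono) auto
  finally have "(norm (log_cutoff_grad c r s w))\<^sup>2 \<le> (4 / (ln (s / r) * norm (w - c)))\<^sup>2"
    by (intro power_mono) auto
  also have "\<dots> = log_density c r s w"
    using n by (simp add: log_density_def indicator_def dist_norm norm_minus_commute
        power_divide power_mult_distrib)
  finally show ?thesis .
qed

lemma measure_cball_complex: "R \<ge> 0 \<Longrightarrow> measure lborel (cball (c::complex) R) = pi * R\<^sup>2"
  by (simp add: content_cball unit_ball_vol_2)

text \<open>The function \<open>1 / (norm (w - c))\<^sup>2\<close> has an integral of order
  \<open>ln (s / r)\<close> over the annulus, and the squared logarithm in the denominator turns
  this into \<open>1 / ln (s / r)\<close>. Dyadic discs replace polar coordinates, at the price of a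
  larger constant.\<close>

lemma
  assumes r: "0 < r" and s: "2 * r \<le> s"
  shows integrable_log_density: "integrable lborel (log_density c r s)"
    and integral_log_density_le: "integral\<^sup>L lborel (log_density c r s) \<le> 256 * pi / ln (s / r)"
proof -
  define L where "L = ln (s / r)"
  have "ln 2 \<le> L" unfolding L_def using r s by (simp add: le_divide_eq)
  have L: "1/2 \<le> L" using \<open>ln 2 \<le> L\<close> ln2_ge_two_thirds by linarith
  \<comment> \<open>As \<open>ln 2 \<ge> 1/2\<close>, this many doublings lead from \<open>r\<close>
    past \<open>s\<close>; as \<open>L \<ge> 1/2\<close>, which is where
    \<open>2 * r \<le> s\<close> enters, rounding up costs at most a factor 2.\<close>
  define n where "n = nat \<lceil>2 * L\<rceil>"
  have n1: "2 * L \<le> real n" unfolding n_def by linarith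
  have n2: "real n \<le> 4 * L" unfolding n_def using L by linarith
  have s_le: "s \<le> 2 ^ n * r"
  proof -
    have "L \<le> real n * (1/2)" using n1 by simp
    also have "\<dots> \<le> real n * ln 2"
      using ln2_ge_two_thirds by (intro mult_left_mono) auto
    also have "\<dots> = ln (2 ^ n)" by (simp add: ln_realpow)
    finally have "s / r \<le> 2 ^ n"
      unfolding L_def using r s by (subst (asm) ln_le_cancel_iff) auto
    then show ?thesis using r by (simp add: field_simps)
  qed
  \<comment> \<open>Each of the \<open>O(ln (s / r))\<close> dyadic annuli contributes a bounded amount.\<close>
  define H where "H w = (\<Sum>k<n. indicator (cball c (2 ^ Suc k * r)) w *\<^sub>R (16 / (L\<^sup>2 * (2 ^ k * r)\<^sup>2)))" for w
  have intH: "integrable lborel H"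
    unfolding H_def by (intro Bochner_Integration.integrable_sum borel_integrable_compact) auto
  have intH_eq: "integral\<^sup>L lborel H = real n * (64 * pi / L\<^sup>2)"
  proof -
    have "integral\<^sup>L lborel H
        = (\<Sum>k<n. integral\<^sup>L lborel (\<lambda>w. indicator (cball c (2 ^ Suc k * r)) w *\<^sub>R (16 / (L\<^sup>2 * (2 ^ k * r)\<^sup>2))))"
      unfolding H_def by (intro Bochner_Integration.integral_sum borel_integrable_compact) auto
    also have "\<dots> = (\<Sum>k<n. 64 * pi / L\<^sup>2)"
    proof (intro sum.cong refl)
      fix k
      have "integral\<^sup>L lborel (\<lambda>w. indicator (cball c (2 ^ Suc k * r)) w *\<^sub>R (16 / (L\<^sup>2 * (2 ^ k * r)\<^sup>2)))
          = pi * (2 ^ Suc k * r)\<^sup>2 * (16 / (L\<^sup>2 * (2 ^ k * r)\<^sup>2))"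
        using r by (subst measure_cball_complex[symmetric, of _ c]) (simp_all add: emeasure_lborel_cball_finite)
      also have "\<dots> = 64 * pi / L\<^sup>2"
        using r by (simp add: power_mult_distrib field_simps)
      finally show "integral\<^sup>L lborel (\<lambda>w. indicator (cball c (2 ^ Suc k * r)) w *\<^sub>R (16 / (L\<^sup>2 * (2 ^ k * r)\<^sup>2)))
          = 64 * pi / L\<^sup>2" .
    qed
    finally show ?thesis by simp
  qed
  have le: "log_density c r s w \<le> H w" for w
  proof (cases "w \<in> cball c s - ball c r")
    case False
    then show ?thesis
      unfolding H_def by (auto simp: log_density_def intro!: sum_nonneg)
  next
    case True
    define x where "x = norm (w - c)"
    have x: "r \<le> x" "x \<le> s" using True by (auto simp: x_def dist_norm norm_minus_commute)
    \<comment> \<open>The first dyadic radius that reaches \<open>x\<close>. The annulus containing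
      \<open>w\<close> has index \<open>m - 1\<close>, except that \<open>m = 0\<close>, which
      forces \<open>x = r\<close>, is assigned to index 0.\<close>
    define m where "m = (LEAST m. x \<le> 2 ^ m * r)"
    have ex: "x \<le> 2 ^ n * r" using x s_le by linarith
    have m: "x \<le> 2 ^ m * r" unfolding m_def using ex by (rule LeastI)
    have mn: "m \<le> n" unfolding m_def using ex by (rule Least_le)
    obtain k where k: "k < n" "2 ^ k * r \<le> x" "x \<le> 2 ^ Suc k * r"
    proof (cases m)
      case 0
      have "n \<noteq> 0" using n1 L by auto
      show ?thesis
        by (rule that[of 0]) (use \<open>n \<noteq> 0\<close> x m 0 r in auto)
    next
      case (Suc k)
      have "\<not> x \<le> 2 ^ k * r"
        using not_less_Least[of k "\<lambda>m. x \<le> 2 ^ m * r"] Suc unfolding m_def by auto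
      then show ?thesis
        by (intro that[of k]) (use Suc m mn in auto)
    qed
    have "log_density c r s w = 16 / (L\<^sup>2 * x\<^sup>2)"
      using True by (simp add: log_density_def L_def x_def)
    also have "\<dots> \<le> 16 / (L\<^sup>2 * (2 ^ k * r)\<^sup>2)"
      using k r L x by (intro divide_left_mono mult_left_mono power_mono mult_pos_pos) auto
    also have "\<dots> = indicator (cball c (2 ^ Suc k * r)) w *\<^sub>R (16 / (L\<^sup>2 * (2 ^ k * r)\<^sup>2))"
      using k(3) by (simp add: x_def dist_norm norm_minus_commute)
    also have "\<dots> \<le> H w"
      unfolding H_def using k(1) by (intro member_le_sum) auto
    finally show ?thesis .
  qed
  have meas: "log_density c r s \<in> borel_measurable lborel"
    unfolding log_density_def[abs_def]
    by (intro borel_measurable_times borel_measurable_indicator borel_measurable_divide borel_measurable_const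
        borel_measurable_power borel_measurable_norm borel_measurable_diff) auto
  show int: "integrable lborel (log_density c r s)"
    by (rule Bochner_Integration.integrable_bound[OF intH meas])
      (use le log_density_nonneg in \<open>auto intro: order_trans[OF _ abs_ge_self]\<close>)
  have "integral\<^sup>L lborel (log_density c r s) \<le> integral\<^sup>L lborel H"
    using int intH le by (intro integral_mono) auto
  also have "\<dots> \<le> 4 * L * (64 * pi / L\<^sup>2)"
    unfolding intH_eq using n2 by (intro mult_right_mono) auto
  also have "\<dots> = 256 * pi / ln (s / r)"
    using L by (simp add: power2_eq_square flip: L_def)
  finally show "integral\<^sup>L lborel (log_density c r s) \<le> 256 * pi / ln (s / r)" .
qed

section \<open>A radial averaging weight around the evaluation point\<close>

lemma continuous_on_step_deriv [continuous_intros]: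
  "continuous_on A f \<Longrightarrow> continuous_on A (\<lambda>x. step_deriv (f x))"
  unfolding step_deriv_def by (intro continuous_intros)

text \<open>What remains of the gradient of a logarithmic cutoff around \<open>a\<close>, with radii
  \<open>r\<close> and \<open>4 * r\<close>, after multiplication by the Cauchy kernel
  \<open>1 / (w - a)\<close>: a nonnegative radial weight.\<close>

definition annulus_kernel :: "complex \<Rightarrow> real \<Rightarrow> complex \<Rightarrow> real" where
  "annulus_kernel a r w =
     step_deriv (ln (norm (w - a) / r) / ln 4) / (ln 4 * (norm (w - a))\<^sup>2)"

lemma log_cutoff_grad_eq_annulus_kernel:
  assumes "0 < r"
  shows "log_cutoff_grad a r (4 * r) w = of_real (annulus_kernel a r w) * (w - a)"
  using assms by (simp add: log_cutoff_grad_def annulus_kernel_def scaleR_conv_of_real)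

lemma annulus_kernel_nonneg: "0 \<le> annulus_kernel a r w"
  by (simp add: annulus_kernel_def step_deriv_bounds)

lemma integrable_annulus_kernel:
  fixes f :: "complex \<Rightarrow> 'b::euclidean_space"
  assumes r: "0 < r" and f: "continuous_on (cball a (4 * r)) f"
  shows "integrable lborel (\<lambda>w. indicator (cball a (4 * r) - ball a r) w *\<^sub>R (annulus_kernel a r w *\<^sub>R f w))"
proof (rule borel_integrable_compact)
  show "compact (cball a (4 * r) - ball a r)"
    by (intro compact_diff) auto
  have "w \<noteq> a" if "w \<in> cball a (4 * r) - ball a r" for w
    using that r by auto
  then show "continuous_on (cball a (4 * r) - ball a r) (\<lambda>w. annulus_kernel a r w *\<^sub>R f w)"
    unfolding annulus_kernel_def using r
    by (intro continuous_intros continuous_on_subset[OF f]) auto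
qed

text \<open>In polar coordinates the integral would be exactly \<open>2 * pi\<close>. A crude lower
  bound suffices, so the weight is estimated on a sub-annulus by a constant.\<close>

lemma integral_annulus_kernel_ge:
  assumes r: "0 < r"
  shows "1/4 \<le> integral\<^sup>L lborel (\<lambda>w. indicator (cball a (4 * r) - ball a r) w *\<^sub>R annulus_kernel a r w)"
    (is "_ \<le> integral\<^sup>L lborel ?k")
proof -
  \<comment> \<open>These radii correspond to the arguments 1/4 and 1/2 of
    \<open>step_deriv\<close>, since \<open>ln 4 = 2 * ln 2\<close>. There the weight is at least
    \<open>3 / (32 * r\<^sup>2)\<close>, and the area is \<open>2 * pi * r\<^sup>2\<close>.\<close>
  define S where "S = cball a (2 * r) - ball a (sqrt 2 * r)"
  have "sqrt 2 * r \<le> 2 * r"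
    using r real_sqrt_le_iff[of 2 4] by (intro mult_right_mono) auto
  then have sub: "ball a (sqrt 2 * r) \<subseteq> cball a (2 * r)" by auto
  have "measure lborel S = measure lborel (cball a (2 * r)) - measure lborel (ball a (sqrt 2 * r))"
    unfolding S_def using sub by (intro measure_Diff) (use emeasure_lborel_cball_finite[of a "2 * r"] in auto)
  also have "\<dots> = pi * (2 * r)\<^sup>2 - pi * (sqrt 2 * r)\<^sup>2"
    using r by (simp add: content_cball content_ball unit_ball_vol_2)
  also have "\<dots> = 2 * pi * r\<^sup>2"
    by (simp add: power_mult_distrib)
  finally have mS: "measure lborel S = 2 * pi * r\<^sup>2" .
  have finS: "emeasure lborel S < \<infinity>"
    using emeasure_mono[of S "cball a (2 * r)" lborel] emeasure_lborel_cball_finite[of a "2 * r"]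
    by (auto simp: S_def)
  have int: "integrable lborel (\<lambda>w. indicator (cball a (4 * r) - ball a r) w *\<^sub>R annulus_kernel a r w)"
    using integrable_annulus_kernel[of r a "\<lambda>_. 1 :: real"] r by simp
  have le: "indicator S w *\<^sub>R (3 / (32 * r\<^sup>2)) \<le> ?k w" for w
  proof (cases "w \<in> S")
    case False
    then show ?thesis by (simp add: annulus_kernel_nonneg)
  next
    case True
    define x where "x = norm (w - a)"
    have x: "sqrt 2 * r \<le> x" "x \<le> 2 * r"
      using True by (auto simp: S_def x_def dist_norm norm_minus_commute)
    have "1 * r \<le> sqrt 2 * r" using r by (intro mult_right_mono) auto
    then have rx: "r \<le> x" using x by simp
    have ln4: "ln (4::real) = 2 * ln 2"
      using ln_realpow[of 2 2] by simp
    have "ln (sqrt 2) \<le> ln (x / r)"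
      using x rx r by (subst ln_le_cancel_iff) (auto simp: field_simps)
    moreover have "ln (sqrt 2) = ln 2 / (2::real)"
      by (simp add: ln_sqrt)
    ultimately have t1: "1/4 \<le> ln (x / r) / ln 4"
      by (simp add: ln4 le_divide_eq)
    have "ln (x / r) \<le> ln 2"
      using x rx r by (subst ln_le_cancel_iff) (auto simp: field_simps)
    then have t2: "ln (x / r) / ln 4 \<le> 1/2"
      by (simp add: ln4 divide_le_eq)
    have "ln 4 \<le> (2::real)" using ln_le_minus_one[of "2::real"] by (simp add: ln4)
    moreover have "x\<^sup>2 \<le> (2 * r)\<^sup>2" using x rx r by (intro power_mono) auto
    ultimately have "ln 4 * x\<^sup>2 \<le> 2 * (2 * r)\<^sup>2"
      by (intro mult_mono) auto
    then have "(3/4) / (2 * (2 * r)\<^sup>2) \<le> step_deriv (ln (x / r) / ln 4) / (ln 4 * x\<^sup>2)"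
      using step_deriv_ge[OF t1 t2] rx r by (intro frac_le) auto
    then have "3 / (32 * r\<^sup>2) \<le> annulus_kernel a r w"
      by (simp add: annulus_kernel_def x_def power_mult_distrib)
    moreover have "w \<in> cball a (4 * r) - ball a r"
      using x rx r by (auto simp: x_def dist_norm norm_minus_commute)
    ultimately show ?thesis using True by simp
  qed
  have "1/4 \<le> measure lborel S * (3 / (32 * r\<^sup>2))"
    using r pi_gt3 unfolding mS by (simp add: field_simps)
  also have "\<dots> = integral\<^sup>L lborel (\<lambda>w. indicator S w *\<^sub>R (3 / (32 * r\<^sup>2)))"
    using finS by (simp add: S_def)
  also have "\<dots> \<le> integral\<^sup>L lborel ?k"
    using int le finS by (intro integral_mono integrable_real_indicator) (auto simp: S_def)
  finally show ?thesis .
qed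

section \<open>Point evaluations and the energy of cutoff functions\<close>

text \<open>Optimising the weight \<open>l\<close> recovers the Cauchy-Schwarz inequality from the
  weighted arithmetic-geometric mean inequality, which can be integrated pointwise.\<close>

lemma square_le_mult_if_le_weighted_sum:
  fixes x A B :: real
  assumes le: "\<And>l. l > 0 \<Longrightarrow> x \<le> l * A / 2 + B / (2 * l)" and "0 \<le> A" "0 \<le> B" "0 \<le> x"
  shows "x\<^sup>2 \<le> A * B"
proof (cases "x = 0")
  case False
  then have x: "x > 0" using assms by simp
  show ?thesis
  proof (cases "A = 0")
    case True
    show ?thesis
    proof (cases "B = 0")
      case True
      then show ?thesis using le[of 1] \<open>A = 0\<close> x by simp
    next
      case B: False
      then show ?thesis using le[of "B / x"] True x assms by (simp add: field_simps)
    qed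
  next
    case A: False
    \<comment> \<open>The weight \<open>x / A\<close> makes the first term \<open>x / 2\<close>,
      which is absorbed on the left.\<close>
    have "x \<le> x / 2 + A * B / (2 * x)"
      using le[of "x / A"] A x assms by (simp add: field_simps)
    then show ?thesis using x by (simp add: field_simps power2_eq_square)
  qed
qed (use assms in simp)

text \<open>
  Here \<open>G\<close> is an integrable majorant of \<open>\<bar>\<nabla>u\<bar>\<^sup>2 / \<bar>w - a\<bar>\<^sup>2\<close>.
\<close>

lemma pointwise_bound_by_cutoff_energy:
  fixes f :: "complex \<Rightarrow> complex" and u G :: "complex \<Rightarrow> real"
  assumes f: "f holomorphic_on U" and U: "open U"
    and intf: "integrable lborel (\<lambda>w. indicator U w * (cmod (f w))\<^sup>2)"
    and K: "compact K" "K \<subseteq> U" "\<And>w. w \<notin> K \<Longrightarrow> u w = 0"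
    and grad: "\<And>w. GDERIV u w :> g w"
    and M: "\<And>w. norm (g w) \<le> M"
    and \<delta>: "0 < \<delta>" "\<And>w. w \<in> ball a \<delta> \<Longrightarrow> u w = 1"
    and G: "integrable lborel G" "\<And>w. (norm (g w))\<^sup>2 \<le> G w * (norm (w - a))\<^sup>2" "\<And>w. 0 \<le> G w"
  shows "(cmod (f a))\<^sup>2 \<le> 64 * (integral\<^sup>L lborel (\<lambda>w. indicator U w * (cmod (f w))\<^sup>2) * integral\<^sup>L lborel G)"
proof -
  define P where "P = integral\<^sup>L lborel (\<lambda>w. indicator U w * (cmod (f w))\<^sup>2)"
  define A where "A = integral\<^sup>L lborel G"
  have P0: "0 \<le> P" unfolding P_def by (intro integral_nonneg_AE) auto
  have A0: "0 \<le> A" unfolding A_def using G(3) by (intro integral_nonneg_AE) auto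
  have aU: "a \<in> U" using K(2,3) \<delta>(2)[of a] \<delta>(1) by (metis centre_in_ball subsetD zero_neq_one)
  \<comment> \<open>The factor 8 combines the loss of a factor 2 in replacing \<open>f\<close> by
    \<open>f a\<close> near \<open>a\<close> with the lower bound 1/4 for the mass of the averaging
    weight.\<close>
  have "cmod (f a) \<le> 8 * (l * P / 2 + A / (2 * l))" if l: "l > 0" for l
  proof (cases "f a = 0")
    case True
    then show ?thesis using l P0 A0 by simp
  next
    case fa: False
    have "continuous (at a) f"
      using f U aU by (meson continuous_on_eq_continuous_at holomorphic_on_imp_continuous_on)
    \<comment> \<open>Continuity stands in for the mean value property: on a small annulus the
      weighted integral of \<open>f\<close> differs from mass times \<open>f a\<close> by at most
      half of the latter.\<close>
    then obtain d1 where d1: "0 < d1" "\<And>w. dist w a < d1 \<Longrightarrow> dist (f w) (f a) < cmod (f a) / 2"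
      using fa unfolding continuous_at_eps_delta by (metis half_gt_zero zero_less_norm_iff)
    obtain d2 where d2: "0 < d2" "ball a d2 \<subseteq> U"
      using U aU open_contains_ball by blast
    define \<rho> where "\<rho> = min \<delta> (min d1 d2) / 5"
    have \<rho>: "0 < \<rho>" "4 * \<rho> < \<delta>" "4 * \<rho> < d1" "4 * \<rho> < d2"
      using \<delta>(1) d1(1) d2(1) by (auto simp: \<rho>_def)
    define R where "R = cball a (4 * \<rho>) - ball a \<rho>"
    define k where "k = annulus_kernel a \<rho>"
    define L where "L = log_cutoff a \<rho> (4 * \<rho>)"
    define gL where "gL = log_cutoff_grad a \<rho> (4 * \<rho>)"
    define h where "h w = f w / (w - a)" for w
    have RU: "cball a (4 * \<rho>) \<subseteq> U" using \<rho> d2 by (auto simp: subset_iff)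
    have L1: "L w = 1" if "w \<notin> ball a \<delta>" for w
      using that \<rho> unfolding L_def by (intro log_cutoff_eq_1) (auto simp: dist_norm norm_minus_commute)
    have L0: "L w = 0" if "w \<in> ball a \<rho>" for w
      using that \<rho> unfolding L_def by (intro log_cutoff_eq_0) (auto simp: dist_norm norm_minus_commute)
    \<comment> \<open>Since \<open>u = 1\<close> where \<open>L \<noteq> 1\<close>, the product \<open>u L\<close> equals \<open>u + L - 1\<close>; it cuts off the pole of
      the Cauchy kernel at \<open>a\<close> as well.\<close>
    have K': "u w + L w - 1 = 0" if "w \<notin> K - ball a \<rho>" for w
    proof (cases "w \<in> K")
      case True
      then have w: "w \<in> ball a \<rho>" using that by blast
      then have "w \<in> ball a \<delta>" using \<rho> by auto
      then show ?thesis using L0[OF w] \<delta>(2)[of w] by simp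
    next
      case False
      then have "w \<notin> ball a \<delta>" using K(3)[of w] \<delta>(2)[of w] by auto
      then show ?thesis using L1 K(3) False by simp
    qed
    have gL_bd: "norm (gL w) \<le> 4 / (ln 4 * \<rho>)" for w
      unfolding gL_def using norm_log_cutoff_grad_le[of \<rho> "4 * \<rho>" a w] \<rho> by simp
    have hol: "h holomorphic_on U - {a}"
      unfolding h_def using f by (intro holomorphic_intros holomorphic_on_subset[OF f]) auto
    have "GDERIV (\<lambda>w. u w + L w - 1) w :> g w + gL w" for w
      using GDERIV_diff[OF GDERIV_add[OF grad GDERIV_log_cutoff[of \<rho> "4 * \<rho>" a w]] GDERIV_const] \<rho>
      by (simp add: L_def gL_def)
    note H = hol open_delete[OF U] compact_diff[OF K(1) open_ball[of a \<rho>]] _ K' this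
        norm_triangle_le[OF add_mono[OF M gL_bd]]
    have sub: "K - ball a \<rho> \<subseteq> U - {a}" using K(2) \<rho> by auto
    have int: "integrable lborel (\<lambda>w. h w * (g w + gL w))"
      by (rule integrable_holomorphic_mult_grad[OF H]) (use sub in auto)
    have int0: "integral\<^sup>L lborel (\<lambda>w. h w * (g w + gL w)) = 0"
      by (rule integral_holomorphic_mult_grad[OF H]) (use sub in auto)
    have hgL: "h w * gL w = indicator R w *\<^sub>R (k w *\<^sub>R f w)" for w
    proof (cases "w \<in> R")
      case True
      then have "w \<noteq> a" using \<rho> by (auto simp: R_def)
      then show ?thesis using True \<rho>
        by (simp add: h_def gL_def k_def log_cutoff_grad_eq_annulus_kernel scaleR_conv_of_real)
    next
      case False
      have "gL w = 0"
        unfolding gL_def using False \<rho>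
        by (intro log_cutoff_grad_eq_0) (auto simp: R_def dist_norm norm_minus_commute)
      then show ?thesis using False by simp
    qed
    have contf: "continuous_on (cball a (4 * \<rho>)) f"
      using f RU by (meson continuous_on_subset holomorphic_on_imp_continuous_on)
    have intL: "integrable lborel (\<lambda>w. h w * gL w)"
      unfolding hgL R_def k_def using \<rho> contf by (intro integrable_annulus_kernel) auto
    \<comment> \<open>The total integral vanishes because \<open>h\<close> is holomorphic off
      \<open>a\<close>. The integral against the gradient of \<open>u\<close> is therefore, up to
      sign, the weighted integral of \<open>f\<close> over the annulus \<open>R\<close>.\<close>
    have intg: "integrable lborel (\<lambda>w. h w * g w)"
      and intg_eq: "integral\<^sup>L lborel (\<lambda>w. h w * g w) = - integral\<^sup>L lborel (\<lambda>w. h w * gL w)"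
    proof -
      have eq: "(\<lambda>w. h w * g w) = (\<lambda>w. h w * (g w + gL w) - h w * gL w)"
        by (simp add: algebra_simps)
      show "integrable lborel (\<lambda>w. h w * g w)"
        unfolding eq using int intL by (rule Bochner_Integration.integrable_diff)
      show "integral\<^sup>L lborel (\<lambda>w. h w * g w) = - integral\<^sup>L lborel (\<lambda>w. h w * gL w)"
        unfolding eq using int intL int0 by (simp add: Bochner_Integration.integral_diff)
    qed
    define I where "I = integral\<^sup>L lborel (\<lambda>w. indicator R w *\<^sub>R k w)"
    have I: "1/4 \<le> I"
      unfolding I_def R_def k_def by (rule integral_annulus_kernel_ge) (rule \<rho>)
    have lower: "cmod (f a) / 2 * I \<le> cmod (integral\<^sup>L lborel (\<lambda>w. h w * gL w))"
    proof -
      have i1: "integrable lborel (\<lambda>w. indicator R w *\<^sub>R (k w *\<^sub>R (f w - f a)))"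
        unfolding R_def k_def using \<rho> contf by (intro integrable_annulus_kernel continuous_intros) auto
      have i2: "integrable lborel (\<lambda>w. indicator R w *\<^sub>R (k w *\<^sub>R (1::real)))"
        unfolding R_def k_def using \<rho> by (intro integrable_annulus_kernel continuous_intros) auto
      then have i2': "integrable lborel (\<lambda>w. indicator R w *\<^sub>R k w)" by simp
      have "integral\<^sup>L lborel (\<lambda>w. h w * gL w)
          = integral\<^sup>L lborel (\<lambda>w. indicator R w *\<^sub>R (k w *\<^sub>R (f w - f a)) + (indicator R w *\<^sub>R k w) *\<^sub>R f a)"
        unfolding hgL by (intro Bochner_Integration.integral_cong refl) (simp add: algebra_simps)
      also have "\<dots> = integral\<^sup>L lborel (\<lambda>w. indicator R w *\<^sub>R (k w *\<^sub>R (f w - f a))) + I *\<^sub>R f a"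
        unfolding I_def using i1 i2' by (subst Bochner_Integration.integral_add) auto
      finally have eq: "integral\<^sup>L lborel (\<lambda>w. h w * gL w)
          = integral\<^sup>L lborel (\<lambda>w. indicator R w *\<^sub>R (k w *\<^sub>R (f w - f a))) + I *\<^sub>R f a" .
      have "cmod (integral\<^sup>L lborel (\<lambda>w. indicator R w *\<^sub>R (k w *\<^sub>R (f w - f a))))
          \<le> integral\<^sup>L lborel (\<lambda>w. cmod (indicator R w *\<^sub>R (k w *\<^sub>R (f w - f a))))"
        by (rule integral_norm_bound)
      also have "\<dots> \<le> integral\<^sup>L lborel (\<lambda>w. (indicator R w *\<^sub>R k w) * (cmod (f a) / 2))"
      proof (rule integral_mono)
        show "integrable lborel (\<lambda>w. cmod (indicator R w *\<^sub>R (k w *\<^sub>R (f w - f a))))"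
          using i1 by (rule integrable_norm)
        show "integrable lborel (\<lambda>w. (indicator R w *\<^sub>R k w) * (cmod (f a) / 2))"
          using i2' by (rule integrable_mult_left)
        show "cmod (indicator R w *\<^sub>R (k w *\<^sub>R (f w - f a))) \<le> (indicator R w *\<^sub>R k w) * (cmod (f a) / 2)" for w
        proof (cases "w \<in> R")
          case True
          then have "dist w a < d1" using \<rho> by (auto simp: R_def dist_commute)
          then have "cmod (f w - f a) \<le> cmod (f a) / 2"
            using d1(2)[of w] by (simp add: dist_norm)
          then have "k w * cmod (f w - f a) \<le> k w * (cmod (f a) / 2)"
            unfolding k_def by (intro mult_left_mono annulus_kernel_nonneg)
          then show ?thesis
            using True annulus_kernel_nonneg[of a \<rho> w] by (simp add: k_def)
        qed simp
      qed
      also have "\<dots> = I * (cmod (f a) / 2)"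
        unfolding I_def by simp
      finally have "cmod (integral\<^sup>L lborel (\<lambda>w. indicator R w *\<^sub>R (k w *\<^sub>R (f w - f a)))) \<le> I * (cmod (f a) / 2)" .
      moreover have "cmod (I *\<^sub>R f a) = I * cmod (f a)" using I by simp
      moreover have "cmod (I *\<^sub>R f a) - cmod (integral\<^sup>L lborel (\<lambda>w. indicator R w *\<^sub>R (k w *\<^sub>R (f w - f a))))
          \<le> cmod (integral\<^sup>L lborel (\<lambda>w. h w * gL w))"
        unfolding eq by (subst add.commute) (rule norm_diff_ineq)
      ultimately show ?thesis
        by (simp only: mult.commute[of _ I])
    qed
    have g0: "g w = 0" if "w \<notin> K" for w
      using GDERIV_eq_0_outside_closed[OF compact_imp_closed[OF K(1)] K(3) grad that] .
    \<comment> \<open>Pointwise, \<open>x * y \<le> l * x\<^sup>2 / 2 + y\<^sup>2 / (2 * l)\<close>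
      separates \<open>f\<close> from the gradient divided by \<open>w - a\<close>.\<close>
    have upper: "cmod (integral\<^sup>L lborel (\<lambda>w. h w * g w)) \<le> l * P / 2 + A / (2 * l)"
    proof -
      have "cmod (integral\<^sup>L lborel (\<lambda>w. h w * g w)) \<le> integral\<^sup>L lborel (\<lambda>w. cmod (h w * g w))"
        by (rule integral_norm_bound)
      also have "\<dots> \<le> integral\<^sup>L lborel (\<lambda>w. (l / 2) * (indicator U w * (cmod (f w))\<^sup>2) + (1 / (2 * l)) * G w)"
      proof (rule integral_mono)
        show "integrable lborel (\<lambda>w. cmod (h w * g w))"
          using intg by (rule integrable_norm)
        show "integrable lborel (\<lambda>w. (l / 2) * (indicator U w * (cmod (f w))\<^sup>2) + (1 / (2 * l)) * G w)"
          using intf G(1) by (intro Bochner_Integration.integrable_add integrable_mult_right)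
        show "cmod (h w * g w) \<le> (l / 2) * (indicator U w * (cmod (f w))\<^sup>2) + (1 / (2 * l)) * G w" for w
        proof (cases "w \<in> K \<and> w \<noteq> a")
          case False
          then have "h w * g w = 0" using g0 by (auto simp: h_def)
          then have "cmod (h w * g w) = 0" by (simp only: norm_zero)
          moreover have "0 \<le> (l / 2) * (indicator U w * (cmod (f w))\<^sup>2) + (1 / (2 * l)) * G w"
            using l G(3)[of w] by (intro add_nonneg_nonneg mult_nonneg_nonneg) auto
          ultimately show ?thesis by linarith
        next
          case True
          define x y where "x = cmod (f w)" and "y = cmod (g w) / cmod (w - a)"
          have "y\<^sup>2 \<le> G w"
            using G(2)[of w] True by (simp add: y_def power_divide divide_le_eq)
          have "0 \<le> (l * x - y)\<^sup>2 / (2 * l)" using l by simp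
          also have "\<dots> = l * x\<^sup>2 / 2 + y\<^sup>2 / (2 * l) - x * y"
            using l by (simp add: power2_eq_square field_simps)
          finally have "x * y \<le> l * x\<^sup>2 / 2 + y\<^sup>2 / (2 * l)" by simp
          also have "y\<^sup>2 / (2 * l) \<le> G w / (2 * l)"
            using \<open>y\<^sup>2 \<le> G w\<close> l by (intro divide_right_mono) auto
          finally have "x * y \<le> l * x\<^sup>2 / 2 + G w / (2 * l)" by simp
          moreover have "cmod (h w * g w) = x * y"
            by (simp add: h_def x_def y_def norm_mult norm_divide)
          moreover have "w \<in> U" using True K(2) by blast
          ultimately show ?thesis by (simp add: x_def)
        qed
      qed
      also have "\<dots> = l * P / 2 + A / (2 * l)"
        using intf G(1) by (simp add: P_def A_def)
      finally show ?thesis .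
    qed
    have "cmod (f a) / 8 = cmod (f a) / 2 * (1/4)" by simp
    also have "\<dots> \<le> cmod (f a) / 2 * I" using I by (intro mult_left_mono) auto
    also have "\<dots> \<le> l * P / 2 + A / (2 * l)" using lower upper intg_eq by simp
    finally show ?thesis by simp
  qed
  then have "(cmod (f a) / 8)\<^sup>2 \<le> P * A"
    using P0 A0 by (intro square_le_mult_if_le_weighted_sum) (auto simp: field_simps)
  then show ?thesis by (simp add: power_divide P_def A_def)
qed

section \<open>Evaluation on the negative real axis\<close>

lemma power2_sum3_le: "(a + b + c)\<^sup>2 \<le> 3 * (a\<^sup>2 + b\<^sup>2 + (c::real)\<^sup>2)"
proof -
  have "0 \<le> (a - b)\<^sup>2 + (b - c)\<^sup>2 + (a - c)\<^sup>2" by simp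
  then show ?thesis by (simp add: power2_eq_square algebra_simps)
qed

text \<open>The density is supported at distance at least \<open>m\<close> from \<open>a\<close>.
  The multiplied form stays meaningful at \<open>w = a\<close>, where a quotient would not.\<close>

lemma log_density_le_mult:
  assumes "0 < m" "\<And>w. w \<in> cball c s - ball c r \<Longrightarrow> m \<le> norm (w - a)"
  shows "log_density c r s w \<le> 1 / m\<^sup>2 * log_density c r s w * (norm (w - a))\<^sup>2"
proof (cases "w \<in> cball c s - ball c r")
  case True
  then have "m\<^sup>2 \<le> (norm (w - a))\<^sup>2"
    using assms by (intro power_mono) auto
  then have "log_density c r s w * m\<^sup>2 \<le> log_density c r s w * (norm (w - a))\<^sup>2"
    by (intro mult_left_mono log_density_nonneg)
  then show ?thesis
    using assms(1) by (simp add: field_simps)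
next
  case False
  then have "log_density c r s w = 0" by (simp add: log_density_def)
  then show ?thesis by simp
qed

text \<open>The cutoff around hole \<open>j\<close> rises from \<open>q j\<close> to
  \<open>s j\<close>, and \<open>B\<close> compares the distance from \<open>a\<close> to that
  annulus with \<open>p j\<close>. The three summands of the constant come from the holes, the
  origin and the outer boundary; \<open>192\<close> is 64 from the point evaluation times 3 from
  squaring a sum of three gradients. The bound does not depend on \<open>x\<close>, as the limit
  inferior requires.\<close>

lemma bergman_bound_negative_axis:
  fixes p q r s :: "nat \<Rightarrow> real" and B T x :: real and f :: "complex \<Rightarrow> complex"
  assumes rad: "\<And>j. 0 < r j" "\<And>j. r j < q j" "\<And>j. 2 * q j \<le> s j"
    and p: "\<And>j. 0 < p j" "\<And>j. r j < p j" "p \<longlonglongrightarrow> 0"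
    and B: "0 < B" "\<And>j. p j \<le> B * (p j - s j)"
    and disj: "\<And>j k. j \<noteq> k \<Longrightarrow> ball (of_real (p j)) (s j) \<inter> ball (complex_of_real (p k)) (s k) = {}"
    and T: "\<And>J. finite J \<Longrightarrow> (\<Sum>j\<in>J. 1 / ((p j)\<^sup>2 * ln (s j / q j))) \<le> T"
    and x: "0 < x" "x < 1/8"
    and D: "D = ball 0 1 - ((\<Union>j. cball (complex_of_real (p j)) (r j)) \<union> {0})"
    and f: "f \<in> bergman_space D"
  shows "(cmod (f (- of_real x)))\<^sup>2
    \<le> 192 * (256 * pi * B\<^sup>2 * T + 1 + 32768 * pi) * (bergman_norm D f)\<^sup>2"
proof -
  define a where "a = - complex_of_real x"
  have hol: "f holomorphic_on D" and intD: "set_integrable lebesgue D (\<lambda>w. (cmod (f w))\<^sup>2)"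
    using f by (auto simp: bergman_space_def)
  have q0: "0 < q j" and qs: "q j < s j" for j
    using rad[of j] by linarith+
  have s0: "0 < s j" for j using q0[of j] qs[of j] by linarith
  have lnq: "0 < ln (s j / q j)" for j using q0[of j] qs[of j] by simp
  have sp: "s j < p j" for j
    using B(1) B(2)[of j] p(1)[of j] by (smt (verit) zero_less_mult_pos)
  \<comment> \<open>The annulus around the origin is so wide that its cutoff has energy at most \<open>1\<close>, even after
    division by \<open>\<bar>w - a\<bar>\<^sup>2\<close>.\<close>
  define \<Lambda> where "\<Lambda> = 1 + 4 * (256 * pi) / x\<^sup>2"
  have \<Lambda>: "1 \<le> \<Lambda>" using x pi_gt_zero by (simp add: \<Lambda>_def)
  define e2 where "e2 = x / 2"
  define e1 where "e1 = e2 * exp (- \<Lambda>)"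
  have e: "0 < e1" "0 < e2" using x by (auto simp: e1_def e2_def)
  have "2 \<le> exp \<Lambda>" using exp_ge_add_one_self[of \<Lambda>] \<Lambda> by linarith
  then have e12: "2 * e1 \<le> e2" using e by (simp add: e1_def exp_minus field_simps)
  have "e2 / e1 = exp \<Lambda>" using e by (simp add: e1_def exp_minus field_simps)
  then have lne: "ln (e2 / e1) = \<Lambda>" by simp
  \<comment> \<open>The holes that matter. For \<open>j\<close> outside \<open>J\<close> one has
    \<open>p j + r j < 2 * p j < e1 / 2\<close>, so that hole lies in the disc around 0 removed from
    \<open>U\<close>. Finiteness of \<open>J\<close> comes from \<open>p\<close> tending to
    0.\<close>
  define J where "J = {j. e1 \<le> 4 * p j}"
  have "\<forall>\<^sub>F j in sequentially. p j < e1 / 4"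
    using p(3) e(1) by (intro order_tendstoD) auto
  then obtain N where N: "\<And>j. j \<ge> N \<Longrightarrow> p j < e1 / 4"
    by (auto simp: eventually_sequentially)
  have "J \<subseteq> {..<N}" using N by (force simp: J_def not_le[symmetric])
  then have finJ: "finite J" using finite_subset by blast
  \<comment> \<open>\<open>U\<close> is an open part of \<open>D\<close>, \<open>K\<close> contains
    the support of the cutoff, and on \<open>V\<close>, an open set containing \<open>a\<close>, the
    cutoff is 1.\<close>
  define U where "U = {w. e1 / 2 < cmod w} \<inter> ball 0 1 \<inter> (\<Inter>j\<in>J. - cball (complex_of_real (p j)) (r j))"
  define K where "K = (cball 0 (1/2) - ball 0 e1) \<inter> (\<Inter>j\<in>J. - ball (complex_of_real (p j)) (q j))"
  define V where "V = {w. e2 < cmod w} \<inter> ball 0 (1/4) \<inter> (\<Inter>j\<in>J. - cball (complex_of_real (p j)) (s j))"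
  have openU: "open U"
    unfolding U_def using finJ by (intro open_Int open_INT open_Compl open_Collect_less continuous_intros) auto
  have openV: "open V"
    unfolding V_def using finJ by (intro open_Int open_INT open_Compl open_Collect_less continuous_intros) auto
  have compK: "compact K"
    unfolding K_def by (intro compact_Int_closed compact_diff closed_INT) auto
  have KU: "K \<subseteq> U"
  proof
    fix w assume w: "w \<in> K"
    have "w \<notin> cball (complex_of_real (p j)) (r j)" if "j \<in> J" for j
      using w that rad(2)[of j] by (auto simp: K_def)
    then show "w \<in> U" using w e by (auto simp: K_def U_def)
  qed
  have UD: "U \<subseteq> D"
  proof
    fix w assume w: "w \<in> U"
    have "w \<notin> cball (complex_of_real (p j)) (r j)" for j
    proof (cases "j \<in> J")
      case False
      have "cmod w \<le> cmod (complex_of_real (p j)) + dist (complex_of_real (p j)) w"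
        using norm_triangle_ineq[of "complex_of_real (p j)" "w - complex_of_real (p j)"]
        by (simp add: dist_norm norm_minus_commute)
      then have "w \<in> cball (complex_of_real (p j)) (r j) \<Longrightarrow> cmod w \<le> p j + r j"
        using p(1)[of j] by simp
      then show ?thesis
        using False w p(2)[of j] by (auto simp: J_def U_def)
    qed (use w in \<open>auto simp: U_def\<close>)
    then show "w \<in> D" using w e by (auto simp: D U_def)
  qed
  have dist_a: "cmod (a - complex_of_real (p j)) = x + p j" for j
  proof -
    have "a - complex_of_real (p j) = - complex_of_real (x + p j)" by (simp add: a_def)
    then have "cmod (a - complex_of_real (p j)) = \<bar>x + p j\<bar>"
      by (simp only: norm_minus_cancel norm_of_real)
    then show ?thesis using x p(1)[of j] by simp
  qed
  have aV: "a \<in> V"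
  proof -
    have "a \<notin> cball (complex_of_real (p j)) (s j)" for j
      using sp[of j] x dist_a[of j] by (simp add: dist_norm norm_minus_commute)
    then show ?thesis
      using x by (simp add: V_def e2_def a_def)
  qed
  obtain \<delta> where \<delta>: "0 < \<delta>" "ball a \<delta> \<subseteq> V"
    using openV aV open_contains_ball by blast

  \<comment> \<open>The cutoff function and its gradient\<close>
  define Lj where "Lj j = log_cutoff (complex_of_real (p j)) (q j) (s j)" for j
  define gj where "gj j = log_cutoff_grad (complex_of_real (p j)) (q j) (s j)" for j
  define L0 where "L0 = log_cutoff (0::complex) e1 e2"
  define g0 where "g0 = log_cutoff_grad (0::complex) e1 e2"
  define LE where "LE = log_cutoff (0::complex) (1/4) (1/2)"
  define gE where "gE = log_cutoff_grad (0::complex) (1/4) (1/2)"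
  \<comment> \<open>The outer discs are disjoint, so at each point at most one summand is nonzero
    and this agrees with the product of the \<open>Lj\<close>, while its gradient is a plain
    sum.\<close>
  define uJ where "uJ w = 1 - (\<Sum>j\<in>J. 1 - Lj j w)" for w
  define gJ where "gJ w = (\<Sum>j\<in>J. gj j w)" for w
  define u where "u w = ((1 - LE w) * L0 w) * uJ w" for w
  define g where "g w = ((1 - LE w) * L0 w) *\<^sub>R gJ w
      + uJ w *\<^sub>R ((1 - LE w) *\<^sub>R g0 w + L0 w *\<^sub>R (0 - gE w))" for w
  have one_hole: "(uJ w = 1 \<and> gJ w = 0) \<or> (\<exists>j\<in>J. uJ w = Lj j w \<and> gJ w = gj j w)" for w
  proof (cases "\<exists>j\<in>J. w \<in> ball (complex_of_real (p j)) (s j)")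
    case True
    then obtain j where j: "j \<in> J" "w \<in> ball (complex_of_real (p j)) (s j)" by blast
    have out: "s k \<le> cmod (w - complex_of_real (p k))" if "k \<noteq> j" for k
      using disj[OF that] j by (force simp: dist_norm norm_minus_commute)
    have "(\<Sum>k\<in>J - {j}. 1 - Lj k w) = 0"
      using out q0 qs by (intro sum.neutral) (auto simp: Lj_def log_cutoff_eq_1)
    moreover have "(\<Sum>k\<in>J - {j}. gj k w) = 0"
      using out q0 qs by (intro sum.neutral) (auto simp: gj_def log_cutoff_grad_eq_0)
    ultimately show ?thesis
      using j(1) by (intro disjI2 bexI[of _ j]) (simp_all add: uJ_def gJ_def sum.remove[OF finJ j(1)])
  next
    case False
    then have out: "s k \<le> cmod (w - complex_of_real (p k))" if "k \<in> J" for k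
      using that by (force simp: dist_norm norm_minus_commute)
    have "(\<Sum>k\<in>J. 1 - Lj k w) = 0"
      using out q0 qs by (intro sum.neutral) (auto simp: Lj_def log_cutoff_eq_1)
    moreover have "gJ w = 0"
      unfolding gJ_def using out q0 qs by (intro sum.neutral) (auto simp: gj_def log_cutoff_grad_eq_0)
    ultimately show ?thesis by (simp add: uJ_def)
  qed
  have uJ_bd: "0 \<le> uJ w" "uJ w \<le> 1" for w
    using one_hole[of w] by (auto simp: Lj_def log_cutoff_bounds)
  have L_bd: "0 \<le> LE w" "LE w \<le> 1" "0 \<le> L0 w" "L0 w \<le> 1" for w
    by (auto simp: LE_def L0_def log_cutoff_bounds)
  have grad: "GDERIV u w :> g w" for w
  proof -
    have J': "GDERIV uJ w :> gJ w"
    proof -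
      have "((\<lambda>w. 1 - (\<Sum>j\<in>J. 1 - Lj j w)) has_derivative (\<lambda>h. 0 - (\<Sum>j\<in>J. 0 - inner h (gj j w)))) (at w)"
        using GDERIV_log_cutoff[OF q0 qs]
        by (intro derivative_intros) (auto simp: gderiv_def Lj_def gj_def)
      then show ?thesis
        unfolding gderiv_def uJ_def[abs_def] gJ_def by (simp add: inner_sum_right sum_negf)
    qed
    have L0': "GDERIV L0 w :> g0 w"
      unfolding L0_def g0_def using e e12 by (intro GDERIV_log_cutoff) auto
    have LE': "GDERIV LE w :> gE w"
      unfolding LE_def gE_def by (intro GDERIV_log_cutoff) auto
    show ?thesis
      unfolding u_def[abs_def] g_def
      by (intro GDERIV_mult GDERIV_diff GDERIV_const J' L0' LE')
  qed
  have norm_g: "norm (g w) \<le> norm (gJ w) + norm (g0 w) + norm (gE w)" for w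
  proof -
    have "norm (((1 - LE w) * L0 w) *\<^sub>R gJ w) \<le> norm (gJ w)"
      using L_bd[of w] by (auto simp: abs_mult intro!: mult_left_le_one_le mult_le_one)
    moreover have "norm (uJ w *\<^sub>R ((1 - LE w) *\<^sub>R g0 w + L0 w *\<^sub>R (0 - gE w)))
        \<le> norm ((1 - LE w) *\<^sub>R g0 w + L0 w *\<^sub>R (0 - gE w))"
      using uJ_bd[of w] by (auto intro!: mult_left_le_one_le)
    moreover have "norm ((1 - LE w) *\<^sub>R g0 w) \<le> norm (g0 w)"
      using L_bd[of w] by (auto intro!: mult_left_le_one_le)
    moreover have "norm (L0 w *\<^sub>R (0 - gE w)) \<le> norm (gE w)"
      using L_bd[of w] by (auto intro!: mult_left_le_one_le)
    ultimately show ?thesis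
      unfolding g_def
      using norm_triangle_ineq[of "((1 - LE w) * L0 w) *\<^sub>R gJ w"
          "uJ w *\<^sub>R ((1 - LE w) *\<^sub>R g0 w + L0 w *\<^sub>R (0 - gE w))"]
        norm_triangle_ineq[of "(1 - LE w) *\<^sub>R g0 w" "L0 w *\<^sub>R (0 - gE w)"]
      by linarith
  qed
  define M where "M = (\<Sum>j\<in>J. 4 / (ln (s j / q j) * q j)) + 4 / (ln (e2 / e1) * e1)
      + 4 / (ln ((1/2) / (1/4)) * (1/4))"
  have M: "norm (g w) \<le> M" for w
  proof -
    have "norm (gJ w) \<le> (\<Sum>j\<in>J. 4 / (ln (s j / q j) * q j))"
      unfolding gJ_def gj_def by (intro sum_norm_le norm_log_cutoff_grad_le q0 qs)
    moreover have "norm (g0 w) \<le> 4 / (ln (e2 / e1) * e1)"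
      unfolding g0_def using e e12 by (intro norm_log_cutoff_grad_le) auto
    moreover have "norm (gE w) \<le> 4 / (ln ((1/2) / (1/4)) * (1/4))"
      unfolding gE_def by (intro norm_log_cutoff_grad_le) auto
    ultimately show ?thesis using norm_g[of w] unfolding M_def by linarith
  qed

  \<comment> \<open>The energy majorant and its integral\<close>
  define dj where "dj j = log_density (complex_of_real (p j)) (q j) (s j)" for j
  define d0 where "d0 = log_density 0 e1 e2"
  define dE where "dE = log_density 0 (1/4) (1/2)"
  \<comment> \<open>Each density is divided by the square of a lower bound for the distance from
    \<open>a\<close> to its annulus: \<open>p j / B\<close>, \<open>x / 2\<close> and
    \<open>1/8\<close>.\<close>
  define G where "G w = 3 * ((\<Sum>j\<in>J. 1 / (p j / B)\<^sup>2 * dj j w) + 1 / (x / 2)\<^sup>2 * d0 w + 1 / (1/8)\<^sup>2 * dE w)" for w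
  have dj_nonneg: "0 \<le> dj j w" for j w by (simp add: dj_def log_density_nonneg)
  have d_nonneg: "0 \<le> d0 w" "0 \<le> dE w" for w by (simp_all add: d0_def dE_def log_density_nonneg)
  have G0: "0 \<le> G w" for w
    unfolding G_def using dj_nonneg d_nonneg
    by (intro mult_nonneg_nonneg add_nonneg_nonneg sum_nonneg) auto
  have cmod_a: "cmod a = x" using x by (simp add: a_def)
  have G1: "(norm (g w))\<^sup>2 \<le> G w * (norm (w - a))\<^sup>2" for w
  proof -
    have bj: "(norm (gJ w))\<^sup>2 \<le> (\<Sum>j\<in>J. 1 / (p j / B)\<^sup>2 * dj j w * (norm (w - a))\<^sup>2)"
    proof -
      have j: "(norm (gj j w))\<^sup>2 \<le> 1 / (p j / B)\<^sup>2 * dj j w * (norm (w - a))\<^sup>2" for j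
      proof -
        have "(norm (gj j w))\<^sup>2 \<le> dj j w"
          unfolding gj_def dj_def by (intro norm_log_cutoff_grad_power2_le q0 qs)
        also have "\<dots> \<le> 1 / (p j / B)\<^sup>2 * dj j w * (norm (w - a))\<^sup>2"
          unfolding dj_def
        proof (rule log_density_le_mult)
          show "0 < p j / B" using p(1) B(1) by simp
          fix v assume v: "v \<in> cball (complex_of_real (p j)) (s j) - ball (complex_of_real (p j)) (q j)"
          \<comment> \<open>Here the negative axis enters: \<open>a\<close> and the centre of the
            hole lie on opposite sides of 0, so their distance is \<open>x + p j\<close> however
            small \<open>x\<close> is.\<close>
          have "x + p j \<le> cmod (v - a) + cmod (v - complex_of_real (p j))"
            using norm_triangle_ineq4[of "v - complex_of_real (p j)" "v - a"] dist_a[of j] by simp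
          then have "p j - s j \<le> cmod (v - a)"
            using v x by (simp add: dist_norm norm_minus_commute)
          moreover have "p j / B \<le> p j - s j"
            using B(1) B(2)[of j] by (simp add: divide_le_eq mult.commute)
          ultimately show "p j / B \<le> cmod (v - a)" by linarith
        qed
        finally show ?thesis .
      qed
      have nn: "0 \<le> 1 / (p j / B)\<^sup>2 * dj j w * (norm (w - a))\<^sup>2" for j
        using dj_nonneg by simp
      show ?thesis
        using one_hole[of w]
      proof (elim disjE bexE conjE)
        assume "gJ w = 0"
        then show ?thesis using nn by (simp add: sum_nonneg)
      next
        fix j assume j': "j \<in> J" "gJ w = gj j w"
        have "(norm (gJ w))\<^sup>2 \<le> 1 / (p j / B)\<^sup>2 * dj j w * (norm (w - a))\<^sup>2"
          unfolding j'(2) by (rule j)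
        also have "\<dots> \<le> (\<Sum>j\<in>J. 1 / (p j / B)\<^sup>2 * dj j w * (norm (w - a))\<^sup>2)"
          using j'(1) finJ nn by (intro member_le_sum) auto
        finally show ?thesis .
      qed
    qed
    have b0: "(norm (g0 w))\<^sup>2 \<le> 1 / (x / 2)\<^sup>2 * d0 w * (norm (w - a))\<^sup>2"
    proof -
      have "(norm (g0 w))\<^sup>2 \<le> d0 w"
        unfolding g0_def d0_def using e e12 by (intro norm_log_cutoff_grad_power2_le) auto
      also have "\<dots> \<le> 1 / (x / 2)\<^sup>2 * d0 w * (norm (w - a))\<^sup>2"
        unfolding d0_def
      proof (rule log_density_le_mult)
        fix v :: complex assume v: "v \<in> cball 0 e2 - ball 0 e1"
        have "x \<le> cmod v + cmod (v - a)"
          using norm_triangle_ineq4[of v "v - a"] cmod_a by simp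
        then show "x / 2 \<le> cmod (v - a)" using v by (simp add: e2_def)
      qed (use x in simp)
      finally show ?thesis .
    qed
    have bE: "(norm (gE w))\<^sup>2 \<le> 1 / (1/8)\<^sup>2 * dE w * (norm (w - a))\<^sup>2"
    proof -
      have "(norm (gE w))\<^sup>2 \<le> dE w"
        unfolding gE_def dE_def by (intro norm_log_cutoff_grad_power2_le) auto
      also have "\<dots> \<le> 1 / (1/8)\<^sup>2 * dE w * (norm (w - a))\<^sup>2"
        unfolding dE_def
      proof (rule log_density_le_mult)
        fix v :: complex assume v: "v \<in> cball 0 (1/2) - ball 0 (1/4)"
        have "cmod v \<le> cmod (v - a) + x"
          using norm_triangle_ineq[of "v - a" a] cmod_a by simp
        then show "1/8 \<le> cmod (v - a)" using v x by simp
      qed simp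
      finally show ?thesis .
    qed
    have "(norm (g w))\<^sup>2 \<le> (norm (gJ w) + norm (g0 w) + norm (gE w))\<^sup>2"
      using norm_g by (intro power_mono) auto
    also have "\<dots> \<le> 3 * ((norm (gJ w))\<^sup>2 + (norm (g0 w))\<^sup>2 + (norm (gE w))\<^sup>2)"
      by (rule power2_sum3_le)
    also have "\<dots> \<le> 3 * ((\<Sum>j\<in>J. 1 / (p j / B)\<^sup>2 * dj j w * (norm (w - a))\<^sup>2)
        + 1 / (x / 2)\<^sup>2 * d0 w * (norm (w - a))\<^sup>2 + 1 / (1/8)\<^sup>2 * dE w * (norm (w - a))\<^sup>2)"
      using bj b0 bE by (intro mult_left_mono add_mono) auto
    also have "\<dots> = G w * (norm (w - a))\<^sup>2"
      unfolding G_def by (simp only: sum_distrib_right ring_distribs mult.assoc)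
    finally show ?thesis .
  qed
  have int_dj: "integrable lborel (dj j)" for j
    unfolding dj_def by (intro integrable_log_density q0 rad)
  have int_d0: "integrable lborel d0"
    unfolding d0_def by (intro integrable_log_density e e12)
  have int_dE: "integrable lborel dE"
    unfolding dE_def by (intro integrable_log_density) auto
  have intG: "integrable lborel G"
    unfolding G_def by (intro integrable_mult_right Bochner_Integration.integrable_add
        Bochner_Integration.integrable_sum int_dj int_d0 int_dE)
  have G_le: "integral\<^sup>L lborel G \<le> 3 * (256 * pi * B\<^sup>2 * T + 1 + 32768 * pi)"
  proof -
    have eq: "integral\<^sup>L lborel G = 3 * ((\<Sum>j\<in>J. 1 / (p j / B)\<^sup>2 * integral\<^sup>L lborel (dj j))
        + 1 / (x / 2)\<^sup>2 * integral\<^sup>L lborel d0 + 1 / (1/8)\<^sup>2 * integral\<^sup>L lborel dE)"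
      unfolding G_def using int_dj int_d0 int_dE
      by (simp add: Bochner_Integration.integral_sum)
    have b1: "(\<Sum>j\<in>J. 1 / (p j / B)\<^sup>2 * integral\<^sup>L lborel (dj j)) \<le> 256 * pi * B\<^sup>2 * T"
    proof -
      have "(\<Sum>j\<in>J. 1 / (p j / B)\<^sup>2 * integral\<^sup>L lborel (dj j))
          \<le> (\<Sum>j\<in>J. 1 / (p j / B)\<^sup>2 * (256 * pi / ln (s j / q j)))"
        unfolding dj_def using q0 rad(3)
        by (intro sum_mono mult_left_mono integral_log_density_le) auto
      also have "\<dots> = 256 * pi * B\<^sup>2 * (\<Sum>j\<in>J. 1 / ((p j)\<^sup>2 * ln (s j / q j)))"
        unfolding sum_distrib_left by (intro sum.cong refl) (simp add: power_divide)
      also have "\<dots> \<le> 256 * pi * B\<^sup>2 * T"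
        using T[OF finJ] by (intro mult_left_mono) auto
      finally show ?thesis .
    qed
    have b2: "1 / (x / 2)\<^sup>2 * integral\<^sup>L lborel d0 \<le> 1"
    proof -
      have "1 / (x / 2)\<^sup>2 * integral\<^sup>L lborel d0 \<le> 1 / (x / 2)\<^sup>2 * (256 * pi / \<Lambda>)"
        unfolding d0_def lne[symmetric] by (intro mult_left_mono integral_log_density_le e e12) auto
      also have "\<dots> = (4 * (256 * pi) / x\<^sup>2) / \<Lambda>"
        by (simp add: power_divide)
      also have "\<dots> \<le> 1"
      proof -
        have "4 * (256 * pi) / x\<^sup>2 \<le> \<Lambda>" by (simp add: \<Lambda>_def)
        then show ?thesis using \<Lambda> by (subst divide_le_eq_1_pos) auto
      qed
      finally show ?thesis .
    qed
    have b3: "1 / (1/8)\<^sup>2 * integral\<^sup>L lborel dE \<le> 32768 * pi"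
    proof -
      have "integral\<^sup>L lborel dE \<le> 256 * pi / ln ((1/2) / (1/4))"
        unfolding dE_def by (intro integral_log_density_le) auto
      also have "\<dots> \<le> 256 * pi / (1/2)"
        using ln2_ge_two_thirds by (intro divide_left_mono) auto
      finally show ?thesis by (simp add: power2_eq_square)
    qed
    show ?thesis unfolding eq by (intro mult_left_mono add_mono b1 b2 b3) auto
  qed

  \<comment> \<open>Support of the cutoff and comparison of norms\<close>
  have u0: "u w = 0" if wK: "w \<notin> K" for w
  proof -
    consider "cmod w > 1/2" | "cmod w < e1" | j where "j \<in> J" "w \<in> ball (complex_of_real (p j)) (q j)"
      using wK unfolding K_def by (auto simp: not_le)
    then show ?thesis
    proof cases
      case 1
      then have "LE w = 1" unfolding LE_def by (intro log_cutoff_eq_1) auto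
      then show ?thesis by (simp add: u_def)
    next
      case 2
      then have "L0 w = 0" unfolding L0_def using e e12 by (intro log_cutoff_eq_0) auto
      then show ?thesis by (simp add: u_def)
    next
      case 3
      have w: "w \<in> ball (complex_of_real (p j)) (s j)" using 3 qs[of j] by auto
      have "s k \<le> cmod (w - complex_of_real (p k))" if "k \<noteq> j" for k
        using disj[OF that] w by (force simp: dist_norm norm_minus_commute)
      then have "(\<Sum>k\<in>J - {j}. 1 - Lj k w) = 0"
        using q0 qs by (intro sum.neutral) (auto simp: Lj_def log_cutoff_eq_1)
      then have "uJ w = Lj j w"
        by (simp add: uJ_def sum.remove[OF finJ 3(1)])
      also have "\<dots> = 0"
        using 3 q0 qs by (simp add: Lj_def log_cutoff_eq_0 dist_norm norm_minus_commute)
      finally show ?thesis by (simp add: u_def)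
    qed
  qed
  have u1: "u w = 1" if "w \<in> ball a \<delta>" for w
  proof -
    have w: "w \<in> V" using that \<delta> by blast
    have "LE w = 0" unfolding LE_def using w by (intro log_cutoff_eq_0) (auto simp: V_def)
    moreover have "L0 w = 1"
      unfolding L0_def using w e e12 by (intro log_cutoff_eq_1) (auto simp: V_def)
    moreover have "uJ w = 1"
      unfolding uJ_def using w q0 qs
      by (force simp: Lj_def V_def dist_norm norm_minus_commute intro!: sum.neutral log_cutoff_eq_1)
    ultimately show ?thesis by (simp add: u_def)
  qed
  have holU: "f holomorphic_on U" using hol UD by (rule holomorphic_on_subset)
  have intU: "integrable lebesgue (\<lambda>w. indicator U w * (cmod (f w))\<^sup>2)"
    using set_integrable_subset[OF intD _ UD] openU unfolding set_integrable_def by simp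
  \<comment> \<open>Continuity of \<open>f\<close> on the open set \<open>U\<close> gives Borel
    measurability, which permits passing from \<open>lebesgue\<close>, used for the Bergman norm, to
    \<open>lborel\<close>.\<close>
  have measU: "(\<lambda>w. indicator U w * (cmod (f w))\<^sup>2) \<in> borel_measurable lborel"
  proof -
    have "continuous_on U (\<lambda>w. (cmod (f w))\<^sup>2)"
      using holU by (intro continuous_intros holomorphic_on_imp_continuous_on)
    then have "(\<lambda>w. indicator U w *\<^sub>R (cmod (f w))\<^sup>2) \<in> borel_measurable borel"
      using openU by (intro borel_measurable_continuous_on_indicator) auto
    then show ?thesis by simp
  qed
  have intU': "integrable lborel (\<lambda>w. indicator U w * (cmod (f w))\<^sup>2)"
    using intU integrable_completion[OF measU] by simp
  have norm_le: "integral\<^sup>L lborel (\<lambda>w. indicator U w * (cmod (f w))\<^sup>2) \<le> (bergman_norm D f)\<^sup>2"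
  proof -
    have "integral\<^sup>L lborel (\<lambda>w. indicator U w * (cmod (f w))\<^sup>2)
        = integral\<^sup>L lebesgue (\<lambda>w. indicator U w * (cmod (f w))\<^sup>2)"
      using integral_completion[OF measU] by simp
    also have "\<dots> \<le> integral\<^sup>L lebesgue (\<lambda>w. indicator D w *\<^sub>R (cmod (f w))\<^sup>2)"
      using intU intD UD unfolding set_integrable_def
      by (intro integral_mono) (auto simp: indicator_def)
    also have "\<dots> = (bergman_norm D f)\<^sup>2"
      unfolding bergman_norm_def set_lebesgue_integral_def
      by (intro real_sqrt_pow2[symmetric] integral_nonneg_AE) auto
    finally show ?thesis .
  qed
  have "(cmod (f a))\<^sup>2 \<le> 64 * (integral\<^sup>L lborel (\<lambda>w. indicator U w * (cmod (f w))\<^sup>2) * integral\<^sup>L lborel G)"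
    by (rule pointwise_bound_by_cutoff_energy[OF holU openU intU' compK KU u0 grad M \<delta>(1) u1 intG G1 G0])
  also have "\<dots> \<le> 64 * ((bergman_norm D f)\<^sup>2 * (3 * (256 * pi * B\<^sup>2 * T + 1 + 32768 * pi)))"
    using norm_le G_le integral_nonneg_AE[of G lborel] G0
    by (intro mult_left_mono mult_mono) auto
  finally show ?thesis by (simp add: a_def mult_ac)
qed

section \<open>From the given radii and series to a uniform bound on the axis\<close>

theorem corollary3:
  fixes r s t :: "nat \<Rightarrow> real" and z :: "nat \<Rightarrow> complex" and D :: "complex set"
  assumes radii: "\<And>j. 0 < r j \<and> r j < s j \<and> s j < t j"
    and centres: "\<And>j. z j \<in> ball 0 1"
    and centres_lim: "z \<longlonglongrightarrow> 0"
    and disj: "\<And>j k. j \<noteq> k \<Longrightarrow> cball (z j) (t j) \<inter> cball (z k) (t k) = {}"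
    and zero_notin: "\<And>j. 0 \<notin> cball (z j) (r j)"
    and t_small: "\<And>j. t j < exp (- 4)"
    and r_small: "\<And>j. (r j)\<^sup>2 < (cmod (z j))\<^sup>2 / 2"
    and cond1: "\<And>j. (r j)\<^sup>2 / (t j)\<^sup>2 + s j / t j + sqrt (2 * ln (s j) / ln (r j)) < 1"
    and cond2: "\<And>j. 2 * ln (t j) / ln (r j) + sqrt (2 * ln (s j) / ln (r j)) + s j / t j < 1"
    and D_eq: "D = ball 0 1 - ((\<Union>j. cball (z j) (r j)) \<union> {0})"
    and sum1: "summable (\<lambda>N. s N / t N)"
    and sum2: "summable (\<lambda>N. sqrt (ln (s N) / ln (r N)))"
    and sum3: "summable (\<lambda>N. - 1 / ln (r N))"
    and z_pos_real: "\<And>N. z N \<in> \<real> \<and> 0 < Re (z N)"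
    and sum4: "summable (\<lambda>N. - 1 / ((Re (z N))\<^sup>2 * ln (r N))
                 + (r N)\<^sup>2 / ((Re (z N))\<^sup>2 - (r N)\<^sup>2)\<^sup>2)"
  shows "Liminf (at 0 within D) (bergman_kernel D) < \<infinity>"
proof -
  define p where "p j = Re (z j)" for j
  \<comment> \<open>The cutoffs have to vanish in a neighbourhood of the closed holes, so their inner radii must
    exceed \<open>r j\<close>.\<close>
  define q where "q j = sqrt (r j * s j)" for j
  have p0: "0 < p j" for j using z_pos_real by (simp add: p_def)
  have zp: "z j = of_real (p j)" for j using z_pos_real[of j] by (simp add: p_def)
  have r0: "0 < r j" and rs: "r j < s j" and st: "s j < t j" for j using radii[of j] by auto
  have s0: "0 < s j" and t0: "0 < t j" for j using r0[of j] rs[of j] st[of j] by linarith+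
  have rp: "r j < p j" for j
    using zero_notin[of j] p0[of j] by (simp add: zp)
  have p_lim: "p \<longlonglongrightarrow> 0"
    using tendsto_Re[OF centres_lim] by (simp add: p_def[abs_def])
  \<comment> \<open>The centres tend to 0, so some \<open>p k\<close> lies in the interval from 0 to
    \<open>p j\<close>. If \<open>t j\<close> reached \<open>p j\<close>, the closed disc around
    \<open>z j\<close> would contain \<open>z k\<close>, against disjointness.\<close>
  have tp: "t j < p j" for j
  proof (rule ccontr)
    assume "\<not> t j < p j"
    then have pt: "p j \<le> t j" by simp
    have "\<forall>\<^sub>F k in sequentially. p k < p j"
      using p_lim p0[of j] by (intro order_tendstoD) auto
    then obtain k where k: "p k < p j"
      by (auto simp: eventually_sequentially)
    have "dist (z j) (z k) = \<bar>p j - p k\<bar>"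
      by (simp add: zp dist_norm flip: of_real_diff)
    then have "z k \<in> cball (z j) (t j)" using k pt p0[of k] by simp
    moreover have "z k \<in> cball (z k) (t k)" using t0[of k] by simp
    moreover have "j \<noteq> k" using k by auto
    ultimately show False using disj by blast
  qed
  have ln_r: "ln (r j) < - 4" for j
  proof -
    have "r j < exp (- 4)" using rs[of j] st[of j] t_small[of j] by linarith
    then show ?thesis using r0[of j] by (metis exp_gt_zero ln_exp ln_less_cancel_iff)
  qed
  \<comment> \<open>The square root in \<open>cond1\<close> is below 1, and dividing by the negative
    number \<open>ln (r j)\<close> reverses the inequality: in effect \<open>s j\<close> exceeds the
    square root of \<open>r j\<close>.\<close>
  have ln_s: "ln (r j) / 2 < ln (s j)" for j
  proof -
    have "0 \<le> (r j)\<^sup>2 / (t j)\<^sup>2" "0 \<le> s j / t j" using s0[of j] t0[of j] by simp_all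
    then have "sqrt (2 * ln (s j) / ln (r j)) < 1" using cond1[of j] by linarith
    then show ?thesis using ln_r[of j] by (simp add: divide_less_eq split: if_splits)
  qed
  have rq: "r j < q j" for j
    unfolding q_def using r0[of j] rs[of j] by (intro real_less_rsqrt) (simp add: power2_eq_square)
  \<comment> \<open>With \<open>ln (r j) < - 4\<close> the bound \<open>ln_s\<close> gives
    \<open>s j / r j > exp 2 > 4\<close>, and \<open>q j\<close> is the geometric mean of
    \<open>r j\<close> and \<open>s j\<close>.\<close>
  have qs: "2 * q j \<le> s j" for j
  proof -
    have "ln 4 = 2 * ln (2::real)" using ln_realpow[of 2 2] by simp
    then have "ln 4 \<le> (2::real)" using ln_le_minus_one[of "2::real"] by simp
    then have "ln (4 * r j) < ln (s j)"
      using ln_r[of j] ln_s[of j] r0[of j] by (simp add: ln_mult)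
    then have "4 * r j \<le> s j" using r0[of j] s0[of j] by simp
    then have "4 * (r j * s j) \<le> (s j)\<^sup>2" using s0[of j] by (simp add: power2_eq_square)
    then have "sqrt (4 * (r j * s j)) \<le> s j" using s0[of j] by (simp add: real_le_lsqrt)
    then show ?thesis by (simp add: q_def real_sqrt_mult)
  qed
  \<comment> \<open>Summability forces \<open>s j / t j\<close> to 0, so one constant
    \<open>B\<close> serves all \<open>j\<close>. Since \<open>t j < p j\<close>, the gap
    \<open>p j - s j\<close> is at least \<open>p j * (1 - s j / t j)\<close>.\<close>
  have "(\<lambda>j. 1 / (1 - s j / t j)) \<longlonglongrightarrow> 1 / (1 - 0)"
    using summable_LIMSEQ_zero[OF sum1] by (intro tendsto_intros) auto
  then have "Bseq (\<lambda>j. 1 / (1 - s j / t j))"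
    by (intro convergent_imp_Bseq convergentI)
  then obtain B where B: "0 < B" "\<And>j. \<bar>1 / (1 - s j / t j)\<bar> \<le> B"
    by (auto elim!: BseqE)
  have pB: "p j \<le> B * (p j - s j)" for j
  proof -
    have lt: "0 < 1 - s j / t j" using st[of j] t0[of j] by simp
    then have "1 \<le> B * (1 - s j / t j)"
      using abs_le_D1[OF B(2)[of j]] by (simp only: pos_divide_le_eq)
    then have "p j * 1 \<le> p j * (B * (1 - s j / t j))"
      using p0[of j] by (intro mult_left_mono) auto
    also have "\<dots> = B * (p j - s j / t j * p j)" by (simp add: algebra_simps)
    also have "\<dots> \<le> B * (p j - s j)"
    proof -
      have "s j / t j * t j \<le> s j / t j * p j"
        using tp[of j] s0[of j] t0[of j] by (intro mult_left_mono) auto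
      then have "s j \<le> s j / t j * p j" using t0[of j] by simp
      then show ?thesis using B(1) by (intro mult_left_mono) auto
    qed
    finally show ?thesis by simp
  qed
  define c where "c N = - 1 / ((Re (z N))\<^sup>2 * ln (r N)) + (r N)\<^sup>2 / ((Re (z N))\<^sup>2 - (r N)\<^sup>2)\<^sup>2" for N
  \<comment> \<open>Choosing \<open>q j\<close> as geometric mean halves
    \<open>ln (s j / r j)\<close>, and \<open>ln_s\<close> halves once more, whence the factor
    4.\<close>
  have c1: "1 / ((p j)\<^sup>2 * ln (s j / q j)) \<le> 4 * c j" for j
  proof -
    have "ln (q j) = (ln (r j) + ln (s j)) / 2"
      using r0[of j] s0[of j] by (simp add: q_def ln_sqrt ln_mult)
    moreover have "0 < q j" using r0[of j] rq[of j] by linarith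
    ultimately have "ln (s j / q j) = (ln (s j) - ln (r j)) / 2"
      using s0[of j] by (simp add: ln_div field_simps)
    then have "- ln (r j) / 4 \<le> ln (s j / q j)" using ln_s[of j] by simp
    then have "1 / ((p j)\<^sup>2 * ln (s j / q j)) \<le> 1 / ((p j)\<^sup>2 * (- ln (r j) / 4))"
      using p0[of j] ln_r[of j] by (intro divide_left_mono mult_left_mono mult_pos_pos) auto
    also have "\<dots> = 4 * (- 1 / ((p j)\<^sup>2 * ln (r j)))" by simp
    also have "\<dots> \<le> 4 * c j" by (simp add: c_def p_def)
    finally show ?thesis .
  qed
  have c0: "0 \<le> c j" for j
    unfolding c_def using ln_r[of j]
    by (intro add_nonneg_nonneg) (auto simp: mult_nonneg_nonpos divide_nonpos_nonpos)
  have T: "(\<Sum>j\<in>J. 1 / ((p j)\<^sup>2 * ln (s j / q j))) \<le> 4 * suminf c" if "finite J" for J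
  proof -
    have "(\<Sum>j\<in>J. 1 / ((p j)\<^sup>2 * ln (s j / q j))) \<le> (\<Sum>j\<in>J. 4 * c j)"
      by (intro sum_mono c1)
    also have "\<dots> = 4 * (\<Sum>j\<in>J. c j)" by (simp add: sum_distrib_left)
    also have "\<dots> \<le> 4 * suminf c"
      using sum4 c0 that by (intro mult_left_mono sum_le_suminf) (auto simp: c_def[abs_def])
    finally show ?thesis .
  qed
  have disj': "ball (complex_of_real (p j)) (s j) \<inter> ball (complex_of_real (p k)) (s k) = {}" if "j \<noteq> k" for j k
  proof -
    have "ball (z j) (s j) \<subseteq> cball (z j) (t j)" "ball (z k) (s k) \<subseteq> cball (z k) (t k)"
      using st[of j] st[of k] by auto
    then show ?thesis using disj[OF that] unfolding zp[symmetric] by blast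
  qed
  have D: "D = ball 0 1 - ((\<Union>j. cball (complex_of_real (p j)) (r j)) \<union> {0})"
    by (simp add: D_eq zp)
  define C where "C = 192 * (256 * pi * B\<^sup>2 * (4 * suminf c) + 1 + 32768 * pi)"
  have C0: "0 \<le> C"
    unfolding C_def using T[of "{}"] by (intro mult_nonneg_nonneg add_nonneg_nonneg) auto
  have K_le: "bergman_kernel D (- of_real x) \<le> ennreal C" if "0 < x" "x < 1/8" for x
    unfolding bergman_kernel_def
  proof (rule SUP_least)
    fix f assume "f \<in> {f \<in> bergman_space D. \<exists>w\<in>D. f w \<noteq> 0}"
    then have "(cmod (f (- of_real x)))\<^sup>2 \<le> C * (bergman_norm D f)\<^sup>2"
      unfolding C_def
      by (intro bergman_bound_negative_axis[OF r0 rq qs p0 rp p_lim B(1) pB disj' T that D]) auto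
    then show "ennreal ((cmod (f (- of_real x)))\<^sup>2 / (bergman_norm D f)\<^sup>2) \<le> ennreal C"
      \<comment> \<open>For norm 0 the quotient is 0 by the convention on division by zero.\<close>
      using C0 by (cases "bergman_norm D f = 0") (auto intro!: ennreal_leI simp: divide_le_eq)
  qed
  have in_D: "- complex_of_real x \<in> D" if "0 < x" "x < 1" for x
  proof -
    have "dist (complex_of_real (p j)) (- complex_of_real x) = x + p j" for j
      using that p0[of j] by (simp add: dist_norm flip: of_real_add)
    then show ?thesis using that rp p0 by (auto simp: D not_le intro: add_strict_increasing2 less_imp_le)
  qed
  \<comment> \<open>Otherwise the kernel would exceed \<open>C\<close> at all points of
    \<open>D\<close> near 0, among them points of the negative axis.\<close>
  have "Liminf (at 0 within D) (bergman_kernel D) \<le> ennreal C"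
  proof (rule ccontr)
    assume "\<not> Liminf (at 0 within D) (bergman_kernel D) \<le> ennreal C"
    then have "\<forall>\<^sub>F w in at 0 within D. ennreal C < bergman_kernel D w"
      by (intro less_LiminfD) (simp add: not_le)
    then obtain d where d: "0 < d" "\<And>w. w \<in> D \<Longrightarrow> w \<noteq> 0 \<Longrightarrow> dist w 0 < d \<Longrightarrow> ennreal C < bergman_kernel D w"
      by (auto simp: eventually_at)
    define x where "x = min (d / 2) (1 / 16)"
    have x: "0 < x" "x < 1/8" "x < d" using d(1) by (auto simp: x_def)
    have "ennreal C < bergman_kernel D (- of_real x)"
      using x by (intro d(2) in_D) auto
    then show False using K_le[OF x(1,2)] by simp
  qed
  also have "\<dots> < \<infinity>" by simp
  finally show ?thesis .
qed

end
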